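(* There is an algorithm that, given an $\mathrm{AT}$-free graph $G$, generates (lists, each exactly once) all $\mathrm{AT}$-free orders of $G$ in constant amortized time per order.
   Context: Graphs are finite and simple. For a vertex $x$, $N(x)$ is its neighborhood and $N[x]=N(x)\cup\{x\}$. An asteroidal triple is a set of three vertices such that every pair of them is connected by a path avoiding the closed neighborhood of the third; a graph is $\mathrm{AT}$-free if it has no asteroidal triple. For vertices $x,y$, a vertex $z$ is between $x$ and $y$ if there is a path from $z$ to $x$ all of whose vertices avoid $N[y]$ and a path from $z$ to $y$ all of whose vertices avoid $N[x]$; $I(x,y)$ denotes the set of vertices between $x$ and $y$. A linear order $<$ of the vertices of $G$ is an $\mathrm{AT}$-free order if for any three vertices $x,y,z$: $z\in I(x,y)$ implies $x<z$ or $y<z$. "Constant amortized time" means the total running time of the generation is $O(N)$, where $N$ is the number of $\mathrm{AT}$-free orders of $G$. *)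

theory Defs
  imports "Graph_Theory.Graph_Theory"
begin

section \<open>AT-free graphs and AT-free orders\<close>

text \<open>
  A finite simple graph is a \<open>pair_graph\<close>: an edge between \<open>x\<close> and \<open>y\<close> is represented by the two
  arcs \<open>(x, y)\<close> and \<open>(y, x)\<close>. Paths are the \<open>vpath\<close>s of the library.
\<close>

definition neighborhood :: "'a pair_pre_digraph \<Rightarrow> 'a \<Rightarrow> 'a set" where
  "neighborhood G x = {y. (x, y) \<in> parcs G}"

definition closed_neighborhood :: "'a pair_pre_digraph \<Rightarrow> 'a \<Rightarrow> 'a set" where
  "closed_neighborhood G x = insert x (neighborhood G x)"

definition path_avoiding :: "'a pair_pre_digraph \<Rightarrow> 'a set \<Rightarrow> 'a \<Rightarrow> 'a \<Rightarrow> bool" where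
  "path_avoiding G A u v \<longleftrightarrow>
     (\<exists>p. vpath p (with_proj G) \<and> hd p = u \<and> last p = v \<and> set p \<inter> A = {})"

definition asteroidal_triple :: "'a pair_pre_digraph \<Rightarrow> 'a set \<Rightarrow> bool" where
  "asteroidal_triple G T \<longleftrightarrow> T \<subseteq> pverts G \<and> card T = 3 \<and>
     (\<forall>x y z. T = {x, y, z} \<longrightarrow> path_avoiding G (closed_neighborhood G z) x y)"

definition AT_free :: "'a pair_pre_digraph \<Rightarrow> bool" where
  "AT_free G \<longleftrightarrow> \<not> (\<exists>T. asteroidal_triple G T)"

text \<open>The set \<open>I(x, y)\<close> of vertices between \<open>x\<close> and \<open>y\<close>.\<close>

definition between :: "'a pair_pre_digraph \<Rightarrow> 'a \<Rightarrow> 'a \<Rightarrow> 'a set" where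
  "between G x y = {z \<in> pverts G.
     path_avoiding G (closed_neighborhood G y) z x \<and>
     path_avoiding G (closed_neighborhood G x) z y}"

text \<open>
  Linear orders are reflexive relations in the library; \<open>r - Id\<close> is the strict part of \<open>r\<close>.
\<close>

definition AT_free_order :: "'a pair_pre_digraph \<Rightarrow> 'a rel \<Rightarrow> bool" where
  "AT_free_order G r \<longleftrightarrow> linear_order_on (pverts G) r \<and>
     (\<forall>x \<in> pverts G. \<forall>y \<in> pverts G. \<forall>z \<in> between G x y. (x, z) \<in> r - Id \<or> (y, z) \<in> r - Id)"


section \<open>Random access machine programs with unit costs\<close>

text \<open>
  The algorithms are structured programs for a random access machine with the uniform cost
  measure. The memory consists of named arrays of natural numbers (a program mentions only finitely
  many names; a scalar variable is cell 0 of an array). The arithmetic operations are addition and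
  truncated subtraction only: unit-cost multiplication of unbounded numbers would be unrealistic.
\<close>

type_synonym memory = "string \<Rightarrow> nat \<Rightarrow> nat"

datatype aexp =
    Const nat
  | Load string aexp
  | Plus aexp aexp
  | Minus aexp aexp

datatype bexp =
    Less aexp aexp
  | Not bexp
  | And bexp bexp

datatype com =
    Skip
  | Store string aexp aexp
  | Seq com com
  | Cond bexp com com
  | While bexp com
  | Emit

primrec aval :: "aexp \<Rightarrow> memory \<Rightarrow> nat" where
  "aval (Const k) s = k"
| "aval (Load a e) s = s a (aval e s)"
| "aval (Plus e1 e2) s = aval e1 s + aval e2 s"
| "aval (Minus e1 e2) s = aval e1 s - aval e2 s"

primrec bval :: "bexp \<Rightarrow> memory \<Rightarrow> bool" where
  "bval (Less e1 e2) s \<longleftrightarrow> aval e1 s < aval e2 s"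
| "bval (Not b) s \<longleftrightarrow> \<not> bval b s"
| "bval (And b1 b2) s \<longleftrightarrow> bval b1 s \<and> bval b2 s"

primrec acost :: "aexp \<Rightarrow> nat" where
  "acost (Const k) = 1"
| "acost (Load a e) = 1 + acost e"
| "acost (Plus e1 e2) = 1 + acost e1 + acost e2"
| "acost (Minus e1 e2) = 1 + acost e1 + acost e2"

primrec bcost :: "bexp \<Rightarrow> nat" where
  "bcost (Less e1 e2) = 1 + acost e1 + acost e2"
| "bcost (Not b) = 1 + bcost b"
| "bcost (And b1 b2) = 1 + bcost b1 + bcost b2"

text \<open>
  \<open>exec c s t os s'\<close>: started in memory \<open>s\<close>, the program \<open>c\<close> terminates in memory \<open>s'\<close> after
  \<open>t\<close> elementary steps, and \<open>os\<close> is the sequence of its outputs.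

  Outputs follow the usual convention for constant amortized time generation: the current object is
  kept in one fixed array, here \<open>''out''\<close>, and \<open>Emit\<close> announces that this array now contains the
  next object. It costs one step, since printing an object of size \<open>n\<close> in full
  would already take \<open>n\<close> steps. Every modification of the array between two announcements is paid
  for by the program, one \<open>Store\<close> per cell.
\<close>

inductive exec :: "com \<Rightarrow> memory \<Rightarrow> nat \<Rightarrow> (nat \<Rightarrow> nat) list \<Rightarrow> memory \<Rightarrow> bool" where
  Skip: "exec Skip s 1 [] s"
| Store: "exec (Store a e1 e2) s (1 + acost e1 + acost e2) []
     (s(a := (s a)(aval e1 s := aval e2 s)))"
| Seq: "exec c1 s1 t1 os1 s2 \<Longrightarrow> exec c2 s2 t2 os2 s3 \<Longrightarrow>
     exec (Seq c1 c2) s1 (t1 + t2) (os1 @ os2) s3"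
| CondTrue: "bval b s \<Longrightarrow> exec c1 s t os s' \<Longrightarrow> exec (Cond b c1 c2) s (1 + bcost b + t) os s'"
| CondFalse: "\<not> bval b s \<Longrightarrow> exec c2 s t os s' \<Longrightarrow> exec (Cond b c1 c2) s (1 + bcost b + t) os s'"
| WhileFalse: "\<not> bval b s \<Longrightarrow> exec (While b c) s (1 + bcost b) [] s"
| WhileTrue: "bval b s1 \<Longrightarrow> exec c s1 t1 os1 s2 \<Longrightarrow> exec (While b c) s2 t2 os2 s3 \<Longrightarrow>
     exec (While b c) s1 (1 + bcost b + t1 + t2) (os1 @ os2) s3"
| Emit: "exec Emit s 1 [s ''out''] s"

text \<open>Programs are deterministic: running time and outputs are determined by the initial memory.\<close>

lemma exec_deterministic:
  assumes "exec c s t os s'" and "exec c s u ps s''"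
  shows "t = u \<and> os = ps \<and> s' = s''"
  using assms
proof (induction arbitrary: u ps s'' rule: exec.induct)
  case (Seq c1 s1 t1 os1 s2 c2 t2 os2 s3)
  from Seq.prems show ?case
    by (cases rule: exec.cases) (use Seq.IH in blast)+
next
  case (WhileTrue b s1 c t1 os1 s2 t2 os2 s3)
  from WhileTrue.prems show ?case
    by (cases rule: exec.cases) (use WhileTrue.hyps WhileTrue.IH in blast)+
qed (erule exec.cases; blast)+

text \<open>
  A graph with vertices \<open>0, \<dots>, n - 1\<close> is given by \<open>n\<close> and its adjacency matrix, stored row by row.
  All other memory cells initially contain 0.
\<close>

definition input :: "nat \<Rightarrow> nat pair_pre_digraph \<Rightarrow> memory" where
  "input n G = (\<lambda>a i.
     if a = ''n'' \<and> i = 0 then n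
     else if a = ''adj'' \<and> i < n * n \<and> (i div n, i mod n) \<in> parcs G then 1
     else 0)"

text \<open>The order in which the elements of a list occur.\<close>

definition order_of_list :: "'a list \<Rightarrow> 'a rel" where
  "order_of_list us = {(us ! i, us ! j) | i j. i \<le> j \<and> j < length us}"

definition lists_each_once :: "'a set \<Rightarrow> 'a list list \<Rightarrow> 'a rel set \<Rightarrow> bool" where
  "lists_each_once V L R \<longleftrightarrow>
     (\<forall>us \<in> set L. distinct us \<and> set us = V) \<and>
     distinct (map order_of_list L) \<and> set (map order_of_list L) = R"

end

theory Submission
  imports Defs "HOL-Combinatorics.Transposition"
begin

text \<open>
  In an AT-free order every vertex is extreme among itself and the later vertices: it is not between
  any two of them. So the orders are generated by backtracking, which repeatedly removes an extreme
  vertex from the set of remaining vertices.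

  In an AT-free graph every set of at least two vertices has at least two extreme vertices. Hence
  below a node of the search tree with \<open>k\<close> remaining vertices there are at least \<open>2\<^sup>k\<^sup>-\<^sup>1\<close> orders. This
  pays for the \<open>O(k\<^sup>3)\<close> steps that are needed to find the extreme vertices at the node, and also for a
  polynomial preprocessing phase that tabulates the components of \<open>G - N[z]\<close> for every \<open>z\<close>.
\<close>

section \<open>Extreme vertices of AT-free graphs\<close>

text \<open>Two requirements shape the program. The cost of a node may depend only on its number
  \<open>k\<close> of remaining vertices and not on \<open>n\<close>, because a deep node has few
  leaves below it to charge. So the array \<open>out\<close> is at once the output and the store of
  the remaining vertices, which occupy the cells from the current depth on; moving along an edge of
  the tree is one swap. And the machine has neither multiplication nor recursion: the
  three-dimensional table of connections is addressed through a table of multiples of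
  \<open>n\<close>, and the tree is walked by a single loop with \<open>pos\<close> as its stack.

  The count of extreme vertices rests on a stronger statement that can be proved by induction: if
  some vertex of \<open>S\<close> lies outside N[p] for a \<open>p\<close> in \<open>S\<close>, then
  an extreme one does. The doubling of the leaves fails only where a single vertex remains, hence
  the factor 2 that accompanies \<open>2 ^ k\<close> below.\<close>

definition arcs_avoiding :: "'a pair_pre_digraph \<Rightarrow> 'a set \<Rightarrow> 'a rel" where
  "arcs_avoiding G A = {(u, v) \<in> parcs G. u \<notin> A \<and> v \<notin> A}"

definition extreme :: "'a pair_pre_digraph \<Rightarrow> 'a \<Rightarrow> 'a set \<Rightarrow> bool" where
  "extreme G z S \<longleftrightarrow> (\<forall>x\<in>S. \<forall>y\<in>S. z \<notin> between G x y)"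

text \<open>Reachability forgets that paths are simple, so connections can be composed freely and
  computed by a transitive closure. Nothing is lost: if \<open>u\<close> is to be prefixed to a path
  that already visits \<open>u\<close>, the suffix starting at \<open>u\<close> is taken
  instead.\<close>

lemma (in pair_wf_digraph) path_avoiding_iff:
  "path_avoiding G A u v \<longleftrightarrow> u \<in> pverts G - A \<and> (u, v) \<in> (arcs_avoiding G A)\<^sup>*"
proof
  assume "path_avoiding G A u v"
  then obtain p where p: "vpath p (with_proj G)" "hd p = u" "last p = v" "set p \<inter> A = {}"
    by (auto simp: path_avoiding_def)
  then have "vwalk p (with_proj G)" by auto
  then have "set p \<inter> A = {} \<Longrightarrow> hd p \<in> pverts G - A \<and> (hd p, last p) \<in> (arcs_avoiding G A)\<^sup>*"
  proof (induction rule: vwalk_induct)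
    case (Cons u v es)
    then have "(u, v) \<in> arcs_avoiding G A"
      by (auto simp: arcs_avoiding_def)
    with Cons show ?case
      by (auto dest: in_arcsD1 intro: converse_rtrancl_into_rtrancl)
  qed auto
  with p show "u \<in> pverts G - A \<and> (u, v) \<in> (arcs_avoiding G A)\<^sup>*" by auto
next
  assume *: "u \<in> pverts G - A \<and> (u, v) \<in> (arcs_avoiding G A)\<^sup>*"
  then have "(u, v) \<in> (arcs_avoiding G A)\<^sup>*" by simp
  then have "u \<in> pverts G - A \<Longrightarrow>
    \<exists>p. vpath p (with_proj G) \<and> hd p = u \<and> last p = v \<and> set p \<inter> A = {}"
  proof (induction rule: converse_rtrancl_induct)
    case base
    then show ?case by (intro exI[of _ "[v]"]) auto
  next
    case (step u w)
    then have uw: "(u, w) \<in> parcs G" "u \<notin> A" "w \<notin> A" by (auto simp: arcs_avoiding_def)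
    with step obtain p where p: "vpath p (with_proj G)" "hd p = w" "last p = v" "set p \<inter> A = {}"
      by (auto dest: in_arcsD2)
    show ?case
    proof (cases "u \<in> set p")
      case False
      with p uw step.prems have "vpath (u # p) (with_proj G)"
        by (auto intro!: vpathI vwalk_consI)
      with p uw show ?thesis
        by (intro exI[of _ "u # p"]) auto
    next
      case True
      then obtain q r where qr: "p = q @ u # r" by (auto simp: in_set_conv_decomp)
      have "set (vwalk_arcs (u # r)) \<subseteq> set (vwalk_arcs p)"
        unfolding qr by (rule set_vwalk_arcs_append2)
      with p qr have "vpath (u # r) (with_proj G)"
        by (auto simp: vpath_def vwalk_def)
      with p qr show ?thesis
        by (intro exI[of _ "u # r"]) auto
    qed
  qed
  with * show "path_avoiding G A u v" by (auto simp: path_avoiding_def)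
qed

context pair_graph
begin

abbreviation conn :: "'a \<Rightarrow> 'a \<Rightarrow> 'a \<Rightarrow> bool" where
  "conn z \<equiv> path_avoiding G (closed_neighborhood G z)"

lemma path_avoiding_verts:
  assumes "path_avoiding G A u v"
  shows "u \<in> pverts G - A" "v \<in> pverts G - A"
proof -
  from assms have *: "u \<in> pverts G - A" "(u, v) \<in> (arcs_avoiding G A)\<^sup>*"
    by (auto simp: path_avoiding_iff)
  from *(2,1) show "v \<in> pverts G - A"
    by induction (auto simp: arcs_avoiding_def dest: in_arcsD2)
qed (use assms in \<open>auto simp: path_avoiding_iff\<close>)

lemma path_avoiding_refl: "u \<in> pverts G - A \<Longrightarrow> path_avoiding G A u u"
  by (auto simp: path_avoiding_iff)

lemma path_avoiding_trans:
  "path_avoiding G A u v \<Longrightarrow> path_avoiding G A v w \<Longrightarrow> path_avoiding G A u w"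
  by (auto simp: path_avoiding_iff)

lemma path_avoiding_sym:
  assumes "path_avoiding G A u v"
  shows "path_avoiding G A v u"
proof -
  have "sym (arcs_avoiding G A)"
    by (auto simp: arcs_avoiding_def sym_def arcs_symmetric)
  then have "sym ((arcs_avoiding G A)\<^sup>*)" by (rule sym_rtrancl)
  with assms path_avoiding_verts[OF assms] show ?thesis
    by (auto simp: path_avoiding_iff dest: symD)
qed

lemma not_in_closed_neighborhood_sym:
  "x \<notin> closed_neighborhood G y \<Longrightarrow> y \<notin> closed_neighborhood G x"
  by (auto simp: closed_neighborhood_def neighborhood_def arcs_symmetric)

lemma between_iff: "z \<in> between G x y \<longleftrightarrow> conn y z x \<and> conn x z y"
  by (auto simp: between_def path_avoiding_iff)

lemma between_commute: "z \<in> between G x y \<longleftrightarrow> z \<in> between G y x"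
  by (auto simp: between_iff)

lemma between_nonadjacent:
  assumes "z \<in> between G x y"
  shows "x \<in> pverts G" "y \<in> pverts G" "z \<in> pverts G"
    "x \<notin> closed_neighborhood G z" "y \<notin> closed_neighborhood G z"
    "x \<notin> closed_neighborhood G y"
  using assms path_avoiding_verts[of _ z x] path_avoiding_verts[of _ z y]
    not_in_closed_neighborhood_sym
  by (auto simp: between_iff)

text \<open>Betweenness supplies two of the three connections of an asteroidal triple, so
  AT-freeness forbids the third.\<close>

lemma between_separated:
  assumes "AT_free G" "z \<in> between G x y"
  shows "\<not> conn z x y"
proof
  assume "conn z x y"
  note n = between_nonadjacent[OF assms(2)]
  have d: "x \<noteq> y" "y \<noteq> z" "x \<noteq> z"
    using n by (auto simp: closed_neighborhood_def)
  \<comment> \<open>\<open>asteroidal_triple\<close> quantifies over all enumerations of the set,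
    hence the six orders of the three vertices.\<close>
  have "conn c a b" if "{x, y, z} = {a, b, c}" for a b c
  proof -
    from that d have "(a, b, c) \<in> {(x, y, z), (x, z, y), (y, x, z), (y, z, x), (z, x, y), (z, y, x)}"
      unfolding set_eq_iff insert_iff empty_iff prod.inject by (metis (full_types))
    with \<open>conn z x y\<close> assms(2) show ?thesis
      by (auto simp: between_iff intro: path_avoiding_sym)
  qed
  then have "asteroidal_triple G {x, y, z}"
    using n d by (simp add: asteroidal_triple_def)
  with assms(1) show False by (auto simp: AT_free_def)
qed

text \<open>The component of \<open>a\<close> in G - N[q] contains no vertex of N[y]: as
  \<open>y\<close> lies outside N[q], such a vertex would pull \<open>y\<close> into the component.
  A walk inside the component therefore avoids N[y] as well.\<close>

lemma conn_transfer:
  assumes "conn q a b" "y \<in> pverts G - closed_neighborhood G q" "\<not> conn q a y"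
  shows "conn y a b"
proof -
  have *: "w \<notin> closed_neighborhood G y" if "conn q a w" for w
  proof
    assume "w \<in> closed_neighborhood G y"
    with that assms(3) have "(y, w) \<in> parcs G"
      by (auto simp: closed_neighborhood_def neighborhood_def)
    moreover from path_avoiding_verts[OF that] have "w \<notin> closed_neighborhood G q" by simp
    ultimately have "conn q w y"
      using assms(2) path_avoiding_verts[OF that]
      by (auto simp: path_avoiding_iff arcs_avoiding_def arcs_symmetric intro!: r_into_rtrancl)
    with that assms(3) show False by (blast intro: path_avoiding_trans)
  qed
  have "a \<in> pverts G - closed_neighborhood G q" by (rule path_avoiding_verts[OF assms(1)])
  from assms(1) have "(a, b) \<in> (arcs_avoiding G (closed_neighborhood G q))\<^sup>*"
    by (simp add: path_avoiding_iff)
  then show ?thesis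
  proof induction
    case base
    from path_avoiding_refl[OF \<open>a \<in> _\<close>] * \<open>a \<in> _\<close> show ?case
      by (auto intro: path_avoiding_refl)
  next
    case (step v w)
    have "conn q a v" "conn q a w"
      using step \<open>a \<in> _\<close> by (auto simp: path_avoiding_iff)
    with * have "v \<notin> closed_neighborhood G y" "w \<notin> closed_neighborhood G y" by auto
    with step have "(v, w) \<in> arcs_avoiding G (closed_neighborhood G y)"
      by (auto simp: arcs_avoiding_def)
    with step show ?case
      by (auto simp: path_avoiding_iff)
  qed
qed

text \<open>
  Let \<open>D q\<close> be the component of \<open>p\<close> in \<open>G - N[q]\<close>. Choose \<open>q\<close> with \<open>D q \<inter> S\<close> as large as possible,
  and, by induction, extreme among all vertices with the same \<open>D q \<inter> S\<close>. If such a \<open>q\<close> were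
  between \<open>x\<close> and \<open>y\<close>, then one of the sets \<open>D x \<inter> S\<close> and \<open>D y \<inter> S\<close> would be larger than
  \<open>D q \<inter> S\<close>, or both would be equal to it.
\<close>

lemma exists_extreme_nonadjacent:
  assumes "AT_free G" "S \<subseteq> pverts G" "p \<in> S" "\<not> S \<subseteq> closed_neighborhood G p"
  shows "\<exists>q \<in> S - closed_neighborhood G p. extreme G q S"
proof -
  have "finite S" using assms(2) finite_verts by (rule finite_subset)
  then show ?thesis using assms(2-4)
  proof (induction S arbitrary: p rule: finite_psubset_induct)
    case (psubset S)
    define X where "X = S - closed_neighborhood G p"
    define D where "D q = {w. conn q p w} \<inter> S" for q
    have "finite X" "X \<noteq> {}" using psubset by (auto simp: X_def)
    define m where "m = Max ((\<lambda>q. card (D q)) ` X)"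
    have "m \<in> (\<lambda>q. card (D q)) ` X"
      unfolding m_def using \<open>finite X\<close> \<open>X \<noteq> {}\<close> by (intro Max_in) auto
    then obtain q0 where q0: "q0 \<in> X" "card (D q0) = m" by auto
    have max: "card (D q) \<le> card (D q0)" if "q \<in> X" for q
      unfolding q0(2) m_def using that \<open>finite X\<close> by auto
    have finD: "finite (D q)" for q unfolding D_def using psubset by auto
    define Q where "Q = {q \<in> X. D q = D q0}"
    have "p \<notin> Q" by (simp add: Q_def X_def closed_neighborhood_def)
    then have "Q \<subset> S" using psubset by (auto simp: Q_def X_def)
    have "q0 \<in> Q" using q0 by (simp add: Q_def)
    have "\<exists>q \<in> Q. extreme G q Q"
    \<comment> \<open>\<open>Q\<close> misses \<open>p\<close>, so the induction hypothesis applies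
      to it unless \<open>Q\<close> is a clique. In a clique no vertex is between two members, since
      betweenness forces \<open>x\<close> outside N[y].\<close>
    proof (cases "\<exists>a \<in> Q. \<not> Q \<subseteq> closed_neighborhood G a")
      case True
      with psubset.IH[OF \<open>Q \<subset> S\<close>] \<open>Q \<subset> S\<close> psubset.prems show ?thesis by blast
    next
      case False
      with \<open>q0 \<in> Q\<close> show ?thesis
        using between_nonadjacent(6) by (fastforce simp: extreme_def)
    qed
    then obtain q where q: "q \<in> Q" "extreme G q Q" by blast
    then have Dq: "D q = D q0" and "q \<in> X" by (auto simp: Q_def)
    then have pq: "p \<in> pverts G - closed_neighborhood G q" "q \<in> pverts G"
      using psubset.prems not_in_closed_neighborhood_sym by (auto simp: X_def)
    have sep: "\<not> conn q x y \<and> y \<in> pverts G - closed_neighborhood G q \<and> y \<in> S" 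
      if "q \<in> between G x y" "y \<in> S" for x y
      using between_separated[OF assms(1) that(1)] between_nonadjacent[OF that(1)] that by auto
    \<comment> \<open>\<open>conn_transfer\<close> carries the component of \<open>p\<close> from G
      - N[q] over to G - N[y]; applied to the trivial path at \<open>p\<close> it also shows that
      \<open>y\<close> is not adjacent to \<open>p\<close>.\<close>
    have toX: "y \<in> X \<and> D q \<subseteq> D y" if "\<not> conn q p y" "q \<in> between G x y" "y \<in> S" for x y
    proof -
      have 1: "conn y p w" if "conn q p w" for w
        using conn_transfer[OF that _ \<open>\<not> conn q p y\<close>] sep[OF \<open>q \<in> between G x y\<close> \<open>y \<in> S\<close>] by auto
      have "conn y p p" by (rule 1) (rule path_avoiding_refl[OF pq(1)])
      then have "p \<notin> closed_neighborhood G y" by (auto dest: path_avoiding_verts)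
      then show ?thesis using that 1 not_in_closed_neighborhood_sym by (auto simp: X_def D_def)
    qed
    \<comment> \<open>If the component of \<open>p\<close> contained \<open>x\<close>, it would not
      contain \<open>y\<close>, and after the transfer to G - N[y] it would reach \<open>q\<close>
      through \<open>x\<close>. So \<open>D y\<close> would gain \<open>q\<close>, which is never in
      \<open>D q\<close>, against maximality.\<close>
    have one: "\<not> conn q p x" if "q \<in> between G x y" "y \<in> S" for x y
    proof
      assume px: "conn q p x"
      with sep[OF that] have npy: "\<not> conn q p y"
        by (meson path_avoiding_sym path_avoiding_trans)
      have "conn y p x" using conn_transfer[OF px _ npy] sep[OF that] by auto
      then have "conn y p q"
        using that by (auto simp: between_iff intro: path_avoiding_trans path_avoiding_sym)
      moreover have "\<not> conn q p q"
        using path_avoiding_verts(2) by (fastforce simp: closed_neighborhood_def)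
      ultimately have "D q \<subset> D y"
        using toX[OF npy that] \<open>q \<in> X\<close> by (auto simp: D_def X_def)
      then have "card (D q) < card (D y)" by (intro psubset_card_mono finD)
      with max[of y] toX[OF npy that] Dq show False by simp
    qed
    have "extreme G q S"
      unfolding extreme_def
    proof (intro ballI notI)
      fix x y assume xy: "x \<in> S" "y \<in> S" "q \<in> between G x y"
      then have yx: "q \<in> between G y x" by (simp add: between_commute)
      have "x \<in> X \<and> D q \<subseteq> D x" "y \<in> X \<and> D q \<subseteq> D y"
        using toX one xy yx by blast+
      moreover from this have "D q = D x" "D q = D y"
        using card_seteq[OF finD, of "D q"] max Dq by metis+
      ultimately have "x \<in> Q" "y \<in> Q" by (auto simp: Q_def Dq)
      with q(2) xy(3) show False by (auto simp: extreme_def)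
    qed
    with \<open>q \<in> X\<close> show ?case by (auto simp: X_def)
  qed
qed

text \<open>Outside a clique, the second application of \<open>exists_extreme_nonadjacent\<close>
  starts at the extreme vertex \<open>q\<close> found by the first, so its result is not adjacent to
  \<open>q\<close> and hence different from it. In a clique every vertex is extreme.\<close>

lemma two_extreme:
  assumes "AT_free G" "S \<subseteq> pverts G" "2 \<le> card S"
  shows "2 \<le> card {q \<in> S. extreme G q S}"
proof (cases "\<exists>a \<in> S. \<not> S \<subseteq> closed_neighborhood G a")
  case True
  then obtain a where a: "a \<in> S" "\<not> S \<subseteq> closed_neighborhood G a" by blast
  have fin: "finite S" using assms(2) finite_verts by (rule finite_subset)
  obtain q where q: "q \<in> S" "q \<notin> closed_neighborhood G a" "extreme G q S"
    using exists_extreme_nonadjacent[OF assms(1,2) a] by blast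
  then have "\<not> S \<subseteq> closed_neighborhood G q"
    using a not_in_closed_neighborhood_sym by blast
  then obtain r where r: "r \<in> S" "r \<notin> closed_neighborhood G q" "extreme G r S"
    using exists_extreme_nonadjacent[OF assms(1,2) q(1)] by blast
  have "r \<noteq> q" using r by (auto simp: closed_neighborhood_def)
  then have "2 = card {q, r}" by simp
  also have "\<dots> \<le> card {q \<in> S. extreme G q S}"
    using q r fin by (intro card_mono) auto
  finally show ?thesis .
next
  case False
  then have "extreme G q S" for q
    using between_nonadjacent(6) by (fastforce simp: extreme_def)
  with assms(3) show ?thesis by simp
qed

end

section \<open>The search tree\<close>

text \<open>\<open>k\<close> counts the unplaced vertices, so \<open>n - k\<close> is the depth.
  Whole functions are listed because \<open>Emit\<close> outputs the whole array; cells from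
  \<open>n\<close> on are carried along unchanged. The swaps are those of the program, so that the
  outputs agree as lists.\<close>

primrec gen :: "(nat \<Rightarrow> nat set \<Rightarrow> bool) \<Rightarrow> nat \<Rightarrow> nat \<Rightarrow> (nat \<Rightarrow> nat) \<Rightarrow> (nat \<Rightarrow> nat) list" where
  "gen E n 0 f = [f]"
| "gen E n (Suc k) f = concat (map (\<lambda>i. gen E n k (f \<circ> transpose (n - Suc k) i))
     (filter (\<lambda>i. E (f i) (f ` {n - Suc k..<n})) [n - Suc k..<n]))"

lemma inj_on_comp_transpose:
  assumes "inj_on f {..<n}" "d < n" "i < n"
  shows "inj_on (f \<circ> transpose d i) {..<n}"
proof -
  have "transpose d i ` {..<n} \<subseteq> {..<n}"
    using assms by (auto simp: transpose_def)
  with assms(1) show ?thesis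
    by (intro comp_inj_on inj_on_transpose) (auto intro: inj_on_subset)
qed

lemma image_comp_transpose_Suc:
  assumes "inj_on f {..<n}" "d \<le> i" "i < n"
  shows "(f \<circ> transpose d i) ` {Suc d..<n} = f ` {d..<n} - {f i}"
proof -
  have "transpose d i ` {Suc d..<n} = {d..<n} - {i}"
  proof -
    have "transpose d i ` {Suc d..<n} = transpose d i ` ({d..<n} - {d})"
      by (rule arg_cong[of _ _ "image (transpose d i)"]) auto
    also have "\<dots> = transpose d i ` {d..<n} - {i}"
      by (subst image_set_diff) (auto simp: inj_on_transpose)
    also have "transpose d i ` {d..<n} = {d..<n}"
      using assms by (intro transpose_image_eq) auto
    finally show ?thesis .
  qed
  then have "(f \<circ> transpose d i) ` {Suc d..<n} = f ` ({d..<n} - {i})"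
    by (metis image_comp)
  also have "\<dots> = f ` {d..<n} - f ` {i}"
    using assms by (intro inj_on_image_set_diff[OF assms(1)]) auto
  finally show ?thesis by simp
qed

text \<open>Fixing \<open>g\<close> outside the permuted segment turns this into an equation between
  sets of functions on all of \<open>nat\<close>. The branch that produces \<open>g\<close> is found
  from the vertex in cell \<open>n - k\<close>: it is the position at which \<open>f\<close> holds
  that vertex.\<close>

lemma set_gen:
  assumes "k \<le> n" "inj_on f {..<n}"
  shows "set (gen E n k f) = {g. inj_on g {..<n} \<and> (\<forall>j. j < n - k \<or> n \<le> j \<longrightarrow> g j = f j) \<and>
    g ` {n - k..<n} = f ` {n - k..<n} \<and> (\<forall>j \<in> {n - k..<n}. E (g j) (g ` {j..<n}))}"
  using assms
proof (induction k arbitrary: f)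
  case 0
  have "g = f" if "\<forall>j. j < n \<or> n \<le> j \<longrightarrow> g j = f j" for g
    using that by (intro ext) (metis not_less)
  with 0 show ?case by auto
next
  case (Suc k)
  define d where "d = n - Suc k"
  then have d: "d < n" "n - k = Suc d" using Suc.prems by auto
  have interval: "{d..<n} = insert d {Suc d..<n}" using d by auto
  define T where "T k f = {g. inj_on g {..<n} \<and> (\<forall>j. j < n - k \<or> n \<le> j \<longrightarrow> g j = f j) \<and>
    g ` {n - k..<n} = f ` {n - k..<n} \<and> (\<forall>j \<in> {n - k..<n}. E (g j) (g ` {j..<n}))}" for k f
  have "set (gen E n (Suc k) f) =
    (\<Union>i \<in> {i \<in> {d..<n}. E (f i) (f ` {d..<n})}. T k (f \<circ> transpose d i))"
    using Suc inj_on_comp_transpose[OF Suc.prems(2) d(1)] by (auto simp flip: d_def simp: T_def)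
  also have "\<dots> = T (Suc k) f"
  proof (intro set_eqI iffI)
    fix g assume "g \<in> (\<Union>i \<in> {i \<in> {d..<n}. E (f i) (f ` {d..<n})}. T k (f \<circ> transpose d i))"
    then obtain i where i: "d \<le> i" "i < n" "E (f i) (f ` {d..<n})" "g \<in> T k (f \<circ> transpose d i)"
      by auto
    then have g: "inj_on g {..<n}" "\<forall>j. j < Suc d \<or> n \<le> j \<longrightarrow> g j = (f \<circ> transpose d i) j"
      "g ` {Suc d..<n} = f ` {d..<n} - {f i}" "\<forall>j \<in> {Suc d..<n}. E (g j) (g ` {j..<n})"
      using image_comp_transpose_Suc[OF Suc.prems(2) i(1,2)] by (auto simp: T_def d)
    from g(2) have "g d = f i" by simp
    have "g ` {d..<n} = insert (g d) (g ` {Suc d..<n})" unfolding interval by simp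
    also have "\<dots> = f ` {d..<n}" using \<open>g d = f i\<close> g(3) i by auto
    finally have image: "g ` {d..<n} = f ` {d..<n}" .
    have "g j = f j" if "j < d \<or> n \<le> j" for j
      using that g(2) i d by (auto simp: transpose_def)
    moreover have "E (g j) (g ` {j..<n})" if "j \<in> {d..<n}" for j
      using that g(4) i(3) image \<open>g d = f i\<close> by (cases "j = d") auto
    ultimately show "g \<in> T (Suc k) f" using g(1) image unfolding T_def d_def[symmetric] by blast
  next
    fix g assume "g \<in> T (Suc k) f"
    then have g: "inj_on g {..<n}" "\<forall>j. j < d \<or> n \<le> j \<longrightarrow> g j = f j"
      "g ` {d..<n} = f ` {d..<n}" "\<forall>j \<in> {d..<n}. E (g j) (g ` {j..<n})"
      by (auto simp: T_def simp flip: d_def)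
    have "g d \<in> f ` {d..<n}" using g(3) d by auto
    then obtain i where i: "d \<le> i" "i < n" "g d = f i" by auto
    have "g ` {Suc d..<n} = g ` ({d..<n} - {d})" using interval by auto
    also have "\<dots> = g ` {d..<n} - g ` {d}"
      using d by (intro inj_on_image_set_diff[OF g(1)]) auto
    finally have "g ` {Suc d..<n} = f ` {d..<n} - {f i}" using g(3) i by simp
    then have "g ` {Suc d..<n} = (f \<circ> transpose d i) ` {Suc d..<n}"
      using image_comp_transpose_Suc[OF Suc.prems(2) i(1,2)] by simp
    moreover have "g j = (f \<circ> transpose d i) j" if "j < Suc d \<or> n \<le> j" for j
      using that g(2) i d by (cases "j = d") (auto simp: transpose_def)
    ultimately have "g \<in> T k (f \<circ> transpose d i)" using g d by (auto simp: T_def)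
    moreover have "E (f i) (f ` {d..<n})" using g(3,4) i d by (metis atLeastLessThan_iff order_refl)
    ultimately show "g \<in> (\<Union>i \<in> {i \<in> {d..<n}. E (f i) (f ` {d..<n})}. T k (f \<circ> transpose d i))"
      using i by auto
  qed
  finally show ?case by (simp add: T_def)
qed

text \<open>Branches \<open>i\<close> and \<open>j\<close> leave the different vertices
  \<open>f i\<close> and \<open>f j\<close> in cell \<open>n - Suc k\<close>, which deeper levels
  never change.\<close>

lemma distinct_gen:
  assumes "k \<le> n" "inj_on f {..<n}"
  shows "distinct (gen E n k f)"
  using assms
proof (induction k arbitrary: f)
  case (Suc k)
  define d where "d = n - Suc k"
  then have d: "d < n" "n - k = Suc d" using Suc.prems by auto
  have at_d: "g d = f i" if "g \<in> set (gen E n k (f \<circ> transpose d i))" "i < n" for g i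
  proof -
    have "\<forall>j. j < n - k \<or> n \<le> j \<longrightarrow> g j = (f \<circ> transpose d i) j"
      using that(1) set_gen[of k n "f \<circ> transpose d i" E]
        inj_on_comp_transpose[OF Suc.prems(2) d(1) that(2)] Suc.prems(1) by simp
    then have "g d = (f \<circ> transpose d i) d" by (simp add: d(2))
    then show ?thesis by simp
  qed
  define t where "t i = gen E n k (f \<circ> transpose d i)" for i
  have dist: "distinct (t i)" if "i < n" for i
    unfolding t_def using d Suc.prems that by (intro Suc.IH inj_on_comp_transpose) auto
  have disj: "set (t i) \<inter> set (t j) = {}" if "i < n" "j < n" "i \<noteq> j" for i j
  proof -
    have "f i \<noteq> f j" using that inj_onD[OF Suc.prems(2), of i j] by auto
    then show ?thesis using at_d[of _ i] at_d[of _ j] that by (fastforce simp: t_def)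
  qed
  have "distinct (concat (map t xs))" if "distinct xs" "set xs \<subseteq> {..<n}" for xs
    using that
  proof (induction xs)
    case (Cons i js)
    then have "set (t i) \<inter> set (t j) = {}" if "j \<in> set js" for j
      using that by (intro disj) auto
    with Cons dist show ?case by auto
  qed simp
  then show ?case by (simp flip: d_def t_def) (auto simp: subset_eq)
qed simp

text \<open>A time budget along the recursion of \<open>gen\<close>: \<open>A * (k + 3)^2\<close>
  for each of the \<open>Suc k\<close> candidates, and one more \<open>A\<close> for the iteration
  that leaves the node. The search uses \<open>A = 1000\<close>.\<close>

primrec gen_cost ::
  "(nat \<Rightarrow> nat set \<Rightarrow> bool) \<Rightarrow> nat \<Rightarrow> nat \<Rightarrow> nat \<Rightarrow> (nat \<Rightarrow> nat) \<Rightarrow> nat" where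
  "gen_cost E n A 0 f = A"
| "gen_cost E n A (Suc k) f = A + Suc k * (A * (k + 3)\<^sup>2) +
     sum_list (map (\<lambda>i. gen_cost E n A k (f \<circ> transpose (n - Suc k) i))
       (filter (\<lambda>i. E (f i) (f ` {n - Suc k..<n})) [n - Suc k..<n]))"

section \<open>Counting leaves and charging the cost of the search tree to them\<close>

lemma image_comp_transpose:
  assumes "f ` {..<n} = {..<n}" "d < n" "i < n"
  shows "(f \<circ> transpose d i) ` {..<n} = {..<n}"
proof -
  have "transpose d i ` {..<n} = {..<n}" using assms by (intro transpose_image_eq) auto
  then show ?thesis using assms by (metis image_comp)
qed

lemma sum_list_ge:
  assumes "\<And>x. x \<in> set xs \<Longrightarrow> (b :: nat) \<le> g x"
  shows "length xs * b \<le> sum_list (map g xs)"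
  using assms by (induction xs) (auto intro!: add_mono)

locale branching =
  fixes E :: "nat \<Rightarrow> nat set \<Rightarrow> bool" and n :: nat
  assumes one: "z < n \<Longrightarrow> E z {z}"
    and two: "S \<subseteq> {..<n} \<Longrightarrow> 2 \<le> card S \<Longrightarrow> 2 \<le> card {z \<in> S. E z S}"
begin

lemma length_filter_extreme:
  assumes "inj_on f {..<n}" "f ` {..<n} = {..<n}" "Suc k \<le> n"
  shows "min 2 (Suc k) \<le> length (filter (\<lambda>i. E (f i) (f ` {n - Suc k..<n})) [n - Suc k..<n])"
proof -
  define S where "S = f ` {n - Suc k..<n}"
  define I where "I = {i \<in> {n - Suc k..<n}. E (f i) S}"
  have inj: "inj_on f {n - Suc k..<n}" using assms(1) by (rule inj_on_subset) auto
  have S: "S \<subseteq> {..<n}" "card S = Suc k"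
    using assms card_image[OF inj] by (auto simp: S_def)
  have "{z \<in> S. E z S} = f ` I" by (auto simp: I_def S_def)
  then have "card {z \<in> S. E z S} \<le> card I"
    by (simp add: card_image_le I_def)
  moreover have "min 2 (Suc k) \<le> card {z \<in> S. E z S}"
  proof (cases k)
    case 0
    then obtain z where z: "S = {z}" using S by (auto simp: card_1_singleton_iff)
    with one[of z] S have "{z \<in> S. E z S} = {z}" by auto
    then show ?thesis using 0 by simp
  next
    case (Suc k')
    then show ?thesis using two[OF S(1)] S(2) by auto
  qed
  moreover have "length (filter (\<lambda>i. E (f i) S) [n - Suc k..<n]) = card I"
  proof -
    have "I = set (filter (\<lambda>i. E (f i) S) [n - Suc k..<n])" by (auto simp: I_def)
    then show ?thesis by (simp only: distinct_card distinct_filter distinct_upt)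
  qed
  ultimately show ?thesis unfolding S_def by linarith
qed

text \<open>The leaves double at every level except the last, where only one vertex is left to
  choose. The factor 2 on the right absorbs that level and avoids a truncated exponent
  \<open>k - 1\<close>.\<close>

lemma length_gen_ge:
  assumes "k \<le> n" "inj_on f {..<n}" "f ` {..<n} = {..<n}"
  shows "2 ^ k \<le> 2 * length (gen E n k f)"
  using assms
proof (induction k arbitrary: f)
  case (Suc k)
  define xs where "xs = filter (\<lambda>i. E (f i) (f ` {n - Suc k..<n})) [n - Suc k..<n]"
  have len: "min 2 (Suc k) \<le> length xs"
    unfolding xs_def using Suc.prems by (intro length_filter_extreme) auto
  have IH: "2 ^ k \<le> 2 * length (gen E n k (f \<circ> transpose (n - Suc k) i))" if "i \<in> set xs" for i
    using that Suc.prems unfolding xs_def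
    by (intro Suc.IH inj_on_comp_transpose image_comp_transpose) auto
  have "length xs * 2 ^ k \<le> sum_list (map (\<lambda>i. 2 * length (gen E n k (f \<circ> transpose (n - Suc k) i))) xs)"
    using IH by (rule sum_list_ge)
  also have "\<dots> = 2 * length (gen E n (Suc k) f)"
    by (simp add: length_concat o_def sum_list_const_mult flip: xs_def)
  finally have *: "length xs * 2 ^ k \<le> 2 * length (gen E n (Suc k) f)" .
  show ?case
  proof (cases k)
    case 0
    have "2 * 1 \<le> 2 * length (gen E n (Suc k) f)"
    proof -
      have "1 * 1 \<le> length xs * 2 ^ k" using len 0 by simp
      then have "1 \<le> 2 * length (gen E n (Suc k) f)" using * by (simp only: mult_1 order_trans)
      then have "1 \<le> length (gen E n (Suc k) f)" by presburger
      then show ?thesis by (rule mult_left_mono) simp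
    qed
    then show ?thesis using 0 by simp
  next
    case (Suc k')
    then have "2 * 2 ^ k \<le> length xs * 2 ^ k" using len by (intro mult_right_mono) auto
    then have "2 * 2 ^ k \<le> 2 * length (gen E n (Suc k) f)" using * by (rule order_trans)
    then show ?thesis by (simp only: power_Suc)
  qed
qed simp

text \<open>
  A node with \<open>k\<close> unplaced vertices costs \<open>O(k\<^sup>3)\<close> and has at least two children if \<open>k \<ge> 2\<close>. The
  potential \<open>h k = (k + 20)\<^sup>3\<close> pays for it, because \<open>2 h (k - 1) - h k\<close> exceeds the cost of the node.
\<close>

lemma gen_cost_le:
  assumes "k \<le> n" "inj_on f {..<n}" "f ` {..<n} = {..<n}"
  shows "gen_cost E n A k f + A * (k + 20) ^ 3 \<le> 10000 * A * length (gen E n k f)"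
  using assms
proof (induction k arbitrary: f)
  case (Suc k)
  define xs where "xs = filter (\<lambda>i. E (f i) (f ` {n - Suc k..<n})) [n - Suc k..<n]"
  define c where "c i = gen_cost E n A k (f \<circ> transpose (n - Suc k) i)" for i
  define l where "l i = length (gen E n k (f \<circ> transpose (n - Suc k) i))" for i
  have len: "min 2 (Suc k) \<le> length xs"
    unfolding xs_def using Suc.prems by (intro length_filter_extreme) auto
  have IH: "c i + A * (k + 20) ^ 3 \<le> 10000 * A * l i" if "i \<in> set xs" for i
    using that Suc.prems unfolding xs_def c_def l_def
    by (intro Suc.IH inj_on_comp_transpose image_comp_transpose) auto
  have cost: "gen_cost E n A (Suc k) f = A + Suc k * (A * (k + 3)\<^sup>2) + sum_list (map c xs)"
    by (simp add: xs_def c_def[abs_def])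
  have length: "length (gen E n (Suc k) f) = sum_list (map l xs)"
    by (simp add: length_concat o_def xs_def l_def[abs_def])
  have "sum_list (map (\<lambda>i. c i + A * (k + 20) ^ 3) xs) \<le> sum_list (map (\<lambda>i. 10000 * A * l i) xs)"
    using IH by (rule sum_list_mono)
  then have *: "sum_list (map c xs) + length xs * (A * (k + 20) ^ 3)
      \<le> 10000 * A * length (gen E n (Suc k) f)"
    unfolding length by (simp add: sum_list_addf sum_list_const_mult sum_list_triv mult.left_commute)
  show ?case
  proof (cases k)
    \<comment> \<open>With a single child nothing doubles. The node and its leaf cost
      \<open>11 * A\<close> together, and 11 + 21 ^ 3 = 9272 fits under the constant 10000.\<close>
    case 0
    then obtain i js where i: "xs = i # js" "js = []"
      using len length_filter_le[of "\<lambda>i. E (f i) (f ` {n - Suc k..<n})" "[n - Suc k..<n]"]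
        Suc.prems unfolding xs_def[symmetric] by (cases xs) auto
    then have "c i = A" "l i = 1" using 0 by (auto simp: c_def l_def)
    then show ?thesis unfolding cost length i using 0 by simp
  next
    case (Suc k')
    then have "2 * (A * (k + 20) ^ 3) \<le> length xs * (A * (k + 20) ^ 3)"
      using len by (intro mult_right_mono) auto
    \<comment> \<open>The cubic terms cancel; due to the shift by 20 the quadratic that remains has
      only positive coefficients.\<close>
    moreover have "1 + Suc k * (k + 3)\<^sup>2 + (Suc k + 20) ^ 3 \<le> 2 * (k + 20) ^ 3"
      by (simp add: power2_eq_square power3_eq_cube algebra_simps)
    then have "A * (1 + Suc k * (k + 3)\<^sup>2 + (Suc k + 20) ^ 3) \<le> A * (2 * (k + 20) ^ 3)"
      by (rule mult_left_mono) simp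
    then have "A + Suc k * (A * (k + 3)\<^sup>2) + A * (Suc k + 20) ^ 3 \<le> 2 * (A * (k + 20) ^ 3)"
      by (simp add: algebra_simps)
    ultimately show ?thesis using * unfolding cost by linarith
  qed
qed simp

end

text \<open>Charges the preprocessing, which is of order n^4, to the exponential number of leaves.
  With the shift by 20 the left side grows by less than a factor 2 per step, already from
  \<open>n = 0\<close> on.\<close>

lemma power4_le_exp: "(n + 20) ^ 4 \<le> 20 ^ 4 * 2 ^ (n :: nat)"
proof (induction n)
  case (Suc n)
  have "(Suc n + 20) ^ 4 \<le> 2 * (n + 20) ^ 4"
    by (simp add: power4_eq_xxxx algebra_simps)
  with Suc show ?case by simp
qed simp

section \<open>Reasoning about programs\<close>

text \<open>Programs without loops and output: the simplifier computes their final memory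
  symbolically, so that only loops need invariants.\<close>

primrec simple :: "com \<Rightarrow> bool" where
  "simple Skip \<longleftrightarrow> True"
| "simple (Store a e1 e2) \<longleftrightarrow> True"
| "simple (Seq c1 c2) \<longleftrightarrow> simple c1 \<and> simple c2"
| "simple (Cond b c1 c2) \<longleftrightarrow> simple c1 \<and> simple c2"
| "simple (While b c) \<longleftrightarrow> False"
| "simple Emit \<longleftrightarrow> False"

text \<open>A constant of its own lets frame properties, saying that a predicate ignores certain
  arrays, be stated as rewrite rules.\<close>

definition put :: "memory \<Rightarrow> string \<Rightarrow> nat \<Rightarrow> nat \<Rightarrow> memory" where
  "put s a i x = s(a := (s a)(i := x))"

lemma put_same [simp]: "put s a i x a = (s a)(i := x)"
  and put_other [simp]: "b \<noteq> a \<Longrightarrow> put s a i x b = s b"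
  by (simp_all add: put_def)

text \<open>On programs that are not \<open>simple\<close>, \<open>effect\<close> and \<open>ccost\<close> have junk values.\<close>

primrec effect :: "com \<Rightarrow> memory \<Rightarrow> memory" where
  "effect Skip s = s"
| "effect (Store a e1 e2) s = put s a (aval e1 s) (aval e2 s)"
| "effect (Seq c1 c2) s = effect c2 (effect c1 s)"
| "effect (Cond b c1 c2) s = (if bval b s then effect c1 s else effect c2 s)"
| "effect (While b c) s = s"
| "effect Emit s = s"

primrec ccost :: "com \<Rightarrow> nat" where
  "ccost Skip = 1"
| "ccost (Store a e1 e2) = 1 + acost e1 + acost e2"
| "ccost (Seq c1 c2) = ccost c1 + ccost c2"
| "ccost (Cond b c1 c2) = 1 + bcost b + ccost c1 + ccost c2"
| "ccost (While b c) = 0"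
| "ccost Emit = 1"

lemma exec_simple: "simple c \<Longrightarrow> \<exists>t \<le> ccost c. exec c s t [] (effect c s)"
proof (induction c arbitrary: s)
  case (Seq c1 c2)
  then obtain t1 t2 where "t1 \<le> ccost c1" "exec c1 s t1 [] (effect c1 s)"
    "t2 \<le> ccost c2" "exec c2 (effect c1 s) t2 [] (effect c2 (effect c1 s))"
    by (metis simple.simps(3))
  then show ?case
    using exec.Seq by (intro exI[of _ "t1 + t2"]) fastforce
next
  case (Cond b c1 c2)
  then obtain t1 t2 where "t1 \<le> ccost c1" "exec c1 s t1 [] (effect c1 s)"
    "t2 \<le> ccost c2" "exec c2 s t2 [] (effect c2 s)"
    by (metis simple.simps(4))
  then show ?case
    using exec.CondTrue[of b s c1 t1 "[]" "effect c1 s" c2]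
      exec.CondFalse[of b s c2 t2 "[]" "effect c2 s" c1]
    by (intro exI[of _ "1 + bcost b + (if bval b s then t1 else t2)"]) auto
qed (auto intro: exec.intros simp: put_def simp flip: One_nat_def)

text \<open>Total correctness with a time bound, for silent runs only: all output comes from the
  main search loop, which is treated by \<open>iter\<close> instead.\<close>

definition hoare :: "(memory \<Rightarrow> bool) \<Rightarrow> com \<Rightarrow> nat \<Rightarrow> (memory \<Rightarrow> bool) \<Rightarrow> bool" where
  "hoare P c T Q \<longleftrightarrow> (\<forall>s. P s \<longrightarrow> (\<exists>t s'. exec c s t [] s' \<and> t \<le> T \<and> Q s'))"

lemma hoareD:
  assumes "hoare P c T Q" "P s"
  obtains t s' where "exec c s t [] s'" "t \<le> T" "Q s'"
  using assms by (auto simp: hoare_def)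

lemma hoare_simple:
  assumes "simple c" "ccost c \<le> T" "\<And>s. P s \<Longrightarrow> Q (effect c s)"
  shows "hoare P c T Q"
  using exec_simple[OF assms(1)] assms(2,3) unfolding hoare_def by (blast intro: order_trans)

lemma hoare_Seq:
  assumes "hoare P c1 T1 Q" "hoare Q c2 T2 R"
  shows "hoare P (Seq c1 c2) (T1 + T2) R"
  unfolding hoare_def
proof (intro allI impI)
  fix s assume "P s"
  obtain t1 s1 where 1: "exec c1 s t1 [] s1" "t1 \<le> T1" "Q s1"
    using hoareD[OF assms(1) \<open>P s\<close>] .
  obtain t2 s2 where 2: "exec c2 s1 t2 [] s2" "t2 \<le> T2" "R s2"
    using hoareD[OF assms(2) \<open>Q s1\<close>] .
  have "exec (Seq c1 c2) s (t1 + t2) ([] @ []) s2"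
    using 1(1) 2(1) by (rule exec.Seq)
  with 1 2 show "\<exists>t s'. exec (Seq c1 c2) s t [] s' \<and> t \<le> T1 + T2 \<and> R s'"
    by (intro exI[of _ "t1 + t2"] exI[of _ s2]) auto
qed

lemma hoare_conseq:
  assumes "hoare P c T Q" "\<And>s. P' s \<Longrightarrow> P s" "\<And>s. Q s \<Longrightarrow> Q' s" "T \<le> T'"
  shows "hoare P' c T' Q'"
  using assms unfolding hoare_def by (blast intro: order_trans)

abbreviation Var :: "string \<Rightarrow> aexp" where
  "Var v \<equiv> Load v (Const 0)"

abbreviation Assign :: "string \<Rightarrow> aexp \<Rightarrow> com" where
  "Assign v e \<equiv> Store v (Const 0) e"

definition For :: "string \<Rightarrow> aexp \<Rightarrow> aexp \<Rightarrow> com \<Rightarrow> com" where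
  "For v lo hi c = Seq (Assign v lo)
     (While (Less (Var v) hi) (Seq c (Assign v (Plus (Var v) (Const 1)))))"

text \<open>By \<open>var\<close> the invariant survives any write to the counter, so initialization
  and increment are harmless; the counter's value is tracked separately. In the constant 10, the
  loop test accounts for 4 and the increment for 6.\<close>

lemma hoare_For:
  assumes init: "\<And>s. P s \<Longrightarrow> aval lo s = d \<and> I d s"
    and body: "\<And>i. d \<le> i \<Longrightarrow> i < N \<Longrightarrow>
      hoare (\<lambda>s. I i s \<and> s v 0 = i) c T (\<lambda>s. I (Suc i) s \<and> s v 0 = i)"
    and hi: "\<And>i s. I i s \<Longrightarrow> aval hi s = N"
    and var: "\<And>i s x. I i s \<Longrightarrow> I i (put s v 0 x)"
    and "d \<le> N"
  shows "hoare P (For v lo hi c) (Suc (N - d) * (T + acost lo + acost hi + 10)) (I N)"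
proof -
  let ?b = "Less (Var v) hi"
  let ?inc = "Assign v (Plus (Var v) (Const 1))"
  have loop: "\<exists>t s'. exec (While ?b (Seq c ?inc)) s t [] s' \<and>
      t \<le> (N - i) * (T + acost hi + 10) + (acost hi + 4) \<and> I N s'"
    if "d \<le> i" "i \<le> N" "I i s" "s v 0 = i" for i s
    using \<open>i \<le> N\<close> that(1,3,4)
  proof (induction arbitrary: s rule: inc_induct)
    case base
    then have "\<not> bval ?b s" using hi by simp
    then have "exec (While ?b (Seq c ?inc)) s (1 + bcost ?b) [] s" by (rule exec.WhileFalse)
    with base show ?case
      by (intro exI[of _ "1 + bcost ?b"] exI[of _ s]) auto
  next
    case (step i)
    obtain t1 s1 where 1: "exec c s t1 [] s1" "t1 \<le> T" "I (Suc i) s1" "s1 v 0 = i"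
      using hoareD[OF body[of i]] step by metis
    define s2 where "s2 = put s1 v 0 (Suc i)"
    have s2: "s2 = s1(v := (s1 v)(aval (Const 0) s1 := aval (Plus (Var v) (Const 1)) s1))"
      using 1(4) by (simp add: s2_def put_def)
    have "exec ?inc s1 (1 + acost (Const 0) + acost (Plus (Var v) (Const 1))) [] s2"
      unfolding s2 by (rule exec.Store)
    with 1(1) have c: "exec (Seq c ?inc) s (t1 + 6) ([] @ []) s2"
      by (intro exec.Seq) (auto simp: numeral_eq_Suc)
    have "I (Suc i) s2" "s2 v 0 = Suc i"
      using 1 var by (auto simp: s2_def)
    then obtain t s3 where 3: "exec (While ?b (Seq c ?inc)) s2 t [] s3" "I N s3"
        "t \<le> (N - Suc i) * (T + acost hi + 10) + (acost hi + 4)"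
      using step.IH[of s2] step.prems by auto
    have "bval ?b s" using step hi by simp
    from exec.WhileTrue[OF this c 3(1)]
    have "exec (While ?b (Seq c ?inc)) s (1 + bcost ?b + (t1 + 6) + t) [] s3"
      by simp
    moreover have "1 + bcost ?b + (t1 + 6) + t \<le> (N - i) * (T + acost hi + 10) + (acost hi + 4)"
    proof -
      have "N - i = Suc (N - Suc i)" using step by auto
      then show ?thesis using 1(2) 3(3) by simp
    qed
    ultimately show ?case using 3(2) by blast
  qed
  show ?thesis unfolding hoare_def
  proof (intro allI impI)
    fix s assume "P s"
    define s1 where "s1 = put s v 0 d"
    have s1: "s1 = s(v := (s v)(aval (Const 0) s := aval lo s))"
      using init[OF \<open>P s\<close>] by (simp add: s1_def put_def)
    have e: "exec (Assign v lo) s (1 + acost (Const 0) + acost lo) [] s1"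
      unfolding s1 by (rule exec.Store)
    have "I d s1" "s1 v 0 = d" using init[OF \<open>P s\<close>] var by (auto simp: s1_def)
    then obtain t s2 where 2: "exec (While ?b (Seq c ?inc)) s1 t [] s2" "I N s2"
        "t \<le> (N - d) * (T + acost hi + 10) + (acost hi + 4)"
      using loop[of d s1] \<open>d \<le> N\<close> by auto
    have "exec (For v lo hi c) s (1 + acost (Const 0) + acost lo + t) [] s2"
      using exec.Seq[OF e 2(1)] unfolding For_def by simp
    moreover have "1 + acost (Const 0) + acost lo + t
        \<le> Suc (N - d) * (T + acost lo + acost hi + 10)"
    proof -
      have "(N - d) * (T + acost hi + 10) \<le> (N - d) * (T + acost lo + acost hi + 10)"
        by (rule mult_left_mono) auto
      then show ?thesis using 2(3) by (simp only: mult_Suc acost.simps)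
    qed
    ultimately show "\<exists>t s'. exec (For v lo hi c) s t [] s' \<and>
        t \<le> Suc (N - d) * (T + acost lo + acost hi + 10) \<and> I N s'"
      using 2(2) by blast
  qed
qed

text \<open>Some iterations of \<open>While b c\<close> without the final failed test. A subtree of
  the search tree corresponds to such a segment of the one main loop, and segments compose.\<close>

inductive iter :: "bexp \<Rightarrow> com \<Rightarrow> memory \<Rightarrow> nat \<Rightarrow> (nat \<Rightarrow> nat) list \<Rightarrow> memory \<Rightarrow> bool" for b c where
  iter_refl: "iter b c s 0 [] s"
| iter_step: "bval b s \<Longrightarrow> exec c s t os s' \<Longrightarrow> iter b c s' t' os' s'' \<Longrightarrow>
    iter b c s (1 + bcost b + t + t') (os @ os') s''"

lemma iter_trans:
  assumes "iter b c s t os s'" "iter b c s' t' os' s''"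
  shows "iter b c s (t + t') (os @ os') s''"
  using assms
proof induction
  case (iter_step s t1 os1 s1 t2 os2 s2)
  then have "iter b c s (1 + bcost b + t1 + (t2 + t')) (os1 @ (os2 @ os')) s''"
    by (intro iter.iter_step) auto
  then show ?case by (simp add: add.assoc)
qed simp

lemma iter_single:
  assumes "bval b s" "exec c s t os s'"
  shows "iter b c s (1 + bcost b + t) os s'"
  using iter_step[OF assms iter_refl] by simp

lemma iter_While:
  assumes "iter b c s t os s'" "\<not> bval b s'"
  shows "exec (While b c) s (t + 1 + bcost b) os s'"
  using assms
proof induction
  case (iter_refl s)
  then show ?case using exec.WhileFalse by fastforce
next
  case (iter_step s t os s' t' os' s'')
  then show ?case
    using exec.WhileTrue[of b s c t os s' "t' + 1 + bcost b" os' s''] by (simp add: add.assoc)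
qed

section \<open>Computing betweenness\<close>

text \<open>Warshall's algorithm: \<open>walks B k\<close> consists of the pairs joined by a nonempty walk in \<open>B\<close> whose
  inner vertices are smaller than \<open>k\<close>.\<close>

primrec walks :: "nat rel \<Rightarrow> nat \<Rightarrow> nat rel" where
  "walks B 0 = B"
| "walks B (Suc k) = walks B k \<union> {(i, j). (i, k) \<in> walks B k \<and> (k, j) \<in> walks B k}"

text \<open>Closure under composition at \<open>m\<close> arises in round \<open>m\<close> and
  survives later rounds, since a pair that passes through the new vertex \<open>k\<close> still does
  so after composition at \<open>m\<close>.\<close>

lemma walks_trans: "(i, m) \<in> walks B k \<Longrightarrow> (m, j) \<in> walks B k \<Longrightarrow> m < k \<Longrightarrow> (i, j) \<in> walks B k"
proof (induction k arbitrary: i m j)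
  case (Suc k)
  show ?case
  proof (cases "m = k")
    case True
    with Suc.prems show ?thesis by auto
  next
    case False
    then have "m < k" using Suc.prems by simp
    with Suc.prems Suc.IH show ?thesis by simp blast
  qed
qed simp

lemma walks_subset_trancl: "walks B k \<subseteq> B\<^sup>+"
proof (induction k)
  case (Suc k)
  then show ?case by (auto intro: trancl_trans)
qed auto

lemma walks_eq_trancl:
  assumes "B \<subseteq> {..<n} \<times> {..<n}"
  shows "walks B n = B\<^sup>+"
proof
  have mono: "B \<subseteq> walks B k" for k by (induction k) auto
  show "B\<^sup>+ \<subseteq> walks B n"
  proof
    fix p assume "p \<in> B\<^sup>+"
    then have "(fst p, snd p) \<in> B\<^sup>+" by simp
    then have "(fst p, snd p) \<in> walks B n"
    proof induction
      case (step y z)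
      with assms mono show ?case by (blast intro: walks_trans)
    qed (use mono in blast)
    then show "p \<in> walks B n" by simp
  qed
qed (rule walks_subset_trancl)

abbreviation cell :: "string \<Rightarrow> aexp \<Rightarrow> aexp \<Rightarrow> aexp" where
  "cell a i j \<equiv> Load a (Plus (Load ''mul'' i) j)"

text \<open>The address \<open>(z * n + i) * n + j\<close> with both products looked up. The outer
  lookup has arguments up to \<open>n * n - 1\<close>, so a table with only \<open>n\<close> entries
  would not do.\<close>

definition index3 :: "aexp \<Rightarrow> aexp \<Rightarrow> aexp \<Rightarrow> aexp" where
  "index3 z i j = Plus (Load ''mul'' (Plus (Load ''mul'' z) i)) j"

definition reach :: "aexp \<Rightarrow> aexp \<Rightarrow> aexp \<Rightarrow> bexp" where
  "reach z i j = Less (Const 0) (Load ''reach'' (index3 z i j))"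

definition near :: "aexp \<Rightarrow> aexp \<Rightarrow> bexp" where
  "near a b = Not (And (Not (Less (Const 0) (cell ''adj'' a b)))
     (Not (And (Not (Less a b)) (Not (Less b a)))))"

definition mul_step :: com where
  "mul_step = Store ''mul'' (Plus (Var ''i'') (Const 1))
     (Plus (Load ''mul'' (Var ''i'')) (Var ''n''))"

text \<open>The bound \<open>n * n\<close> of the second loop is available only as entry
  \<open>n\<close> of the table itself, hence the first pass.\<close>

definition make_mul :: com where
  "make_mul = Seq (For ''i'' (Const 0) (Var ''n'') mul_step)
     (For ''i'' (Const 0) (Load ''mul'' (Var ''n'')) mul_step)"

definition make_out :: com where
  "make_out = For ''i'' (Const 0) (Var ''n'') (Store ''out'' (Var ''i'') (Var ''i''))"

definition set_reach :: com where
  "set_reach = Store ''reach'' (index3 (Var ''z'') (Var ''i'') (Var ''j'')) (Const 1)"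

definition start_cell :: com where
  "start_cell = Cond (And (near (Var ''i'') (Var ''j''))
     (And (Not (near (Var ''z'') (Var ''i''))) (Not (near (Var ''z'') (Var ''j'')))))
     set_reach Skip"

definition warshall_cell :: com where
  "warshall_cell = Cond (And (reach (Var ''z'') (Var ''i'') (Var ''k''))
     (reach (Var ''z'') (Var ''k'') (Var ''j''))) set_reach Skip"

definition make_reach :: com where
  "make_reach = For ''z'' (Const 0) (Var ''n'')
     (Seq
       (For ''i'' (Const 0) (Var ''n'') (For ''j'' (Const 0) (Var ''n'') start_cell))
       (For ''k'' (Const 0) (Var ''n'')
         (For ''i'' (Const 0) (Var ''n'') (For ''j'' (Const 0) (Var ''n'') warshall_cell))))"

definition mul_table :: "nat \<Rightarrow> memory \<Rightarrow> bool" where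
  "mul_table n s \<longleftrightarrow> s ''n'' 0 = n \<and> (\<forall>m \<le> n * n. s ''mul'' m = m * n)"

lemma make_mul: "hoare (\<lambda>s. s ''n'' 0 = n \<and> s ''mul'' 0 = 0 \<and> F s) make_mul (100 * (n + 1) ^ 2)
  (\<lambda>s. mul_table n s \<and> F s)"
  if F: "\<And>s m x. F s \<Longrightarrow> F (put s ''mul'' m x)"
    "\<And>s x. F s \<Longrightarrow> F (put s ''i'' 0 x)"
proof -
  define I where "I i s \<longleftrightarrow> s ''n'' 0 = n \<and> (\<forall>m \<le> i. s ''mul'' m = m * n) \<and> F s" for i :: nat and s
  have 1: "hoare (\<lambda>s. s ''n'' 0 = n \<and> s ''mul'' 0 = 0 \<and> F s)
      (For ''i'' (Const 0) (Var ''n'') mul_step)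
      (Suc (n - 0) * (20 + acost (Const 0) + acost (Var ''n'') + 10)) (I n)"
  proof (rule hoare_For)
    show "hoare (\<lambda>s. I i s \<and> s ''i'' 0 = i) mul_step 20 (\<lambda>s. I (Suc i) s \<and> s ''i'' 0 = i)" for i
      by (rule hoare_simple) (auto simp: mul_step_def I_def le_Suc_eq F)
  qed (auto simp: I_def F)
  \<comment> \<open>The second pass overwrites the first entries with the same values, so the bound
    read from entry \<open>n\<close> stays correct.\<close>
  define J where "J i s \<longleftrightarrow> s ''n'' 0 = n \<and> (\<forall>m \<le> max n i. s ''mul'' m = m * n) \<and> F s"
    for i :: nat and s
  have 2: "hoare (I n) (For ''i'' (Const 0) (Load ''mul'' (Var ''n'')) mul_step)
      (Suc (n * n - 0) * (20 + acost (Const 0) + acost (Load ''mul'' (Var ''n'')) + 10)) (J (n * n))"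
  proof (rule hoare_For)
    show "hoare (\<lambda>s. J i s \<and> s ''i'' 0 = i) mul_step 20 (\<lambda>s. J (Suc i) s \<and> s ''i'' 0 = i)" for i
      by (rule hoare_simple) (auto simp: mul_step_def J_def le_max_iff_disj le_Suc_eq F)
  qed (auto simp: I_def J_def F)
  show ?thesis unfolding make_mul_def
    by (rule hoare_conseq[OF hoare_Seq[OF 1 2]])
      (auto simp: J_def mul_table_def power2_eq_square algebra_simps)
qed

lemma make_out: "hoare (\<lambda>s. s ''n'' 0 = n \<and> F s) make_out (100 * (n + 1))
  (\<lambda>s. (\<forall>m < n. s ''out'' m = m) \<and> F s)"
  if F: "\<And>s m x. F s \<Longrightarrow> F (put s ''out'' m x)"
    "\<And>s x. F s \<Longrightarrow> F (put s ''i'' 0 x)"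
proof -
  define I where "I i s \<longleftrightarrow> s ''n'' 0 = n \<and> (\<forall>m < i. s ''out'' m = m) \<and> F s" for i :: nat and s
  have 1: "hoare (\<lambda>s. s ''n'' 0 = n \<and> F s) make_out
      (Suc (n - 0) * (20 + acost (Const 0) + acost (Var ''n'') + 10)) (I n)"
    unfolding make_out_def
  proof (rule hoare_For)
    show "hoare (\<lambda>s. I i s \<and> s ''i'' 0 = i) (Store ''out'' (Var ''i'') (Var ''i'')) 20
      (\<lambda>s. I (Suc i) s \<and> s ''i'' 0 = i)" for i
      by (rule hoare_simple) (auto simp: I_def less_Suc_eq F)
  qed (auto simp: I_def F)
  show ?thesis
    by (rule hoare_conseq[OF 1]) (auto simp: I_def)
qed

lemma index3_inj:
  fixes n :: nat
  assumes "(z * n + i) * n + j = (z' * n + i') * n + j'" "i < n" "j < n" "i' < n" "j' < n"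
  shows "z = z' \<and> i = i' \<and> j = j'"
proof -
  have *: "a = c \<and> b = d" if "a * n + b = c * n + d" "b < n" "d < n" for a b c d
    using that by (metis add.commute div_mult_self3 div_less add_cancel_right_left mod_mult_self3 mod_less
      gr_implies_not_zero)
  show ?thesis using *[of _ j _ j'] *[of _ i _ i'] assms by metis
qed

lemma aval_index3:
  assumes "mul_table n s" "aval z s < n" "aval i s < n"
  shows "aval (index3 z i j) s = (aval z s * n + aval i s) * n + aval j s"
proof -
  have "aval z s * n + aval i s \<le> n * n"
  proof -
    have "aval z s * n + aval i s \<le> aval z s * n + n" using assms by simp
    also have "\<dots> = Suc (aval z s) * n" by simp
    also have "\<dots> \<le> n * n" using assms by (intro mult_right_mono) auto
    finally show ?thesis .
  qed
  moreover have "aval z s \<le> n * n" using assms by (meson le_square less_imp_le order_trans)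
  ultimately show ?thesis using assms by (auto simp: index3_def mul_table_def)
qed

definition reached :: "nat \<Rightarrow> memory \<Rightarrow> nat \<Rightarrow> nat rel" where
  "reached n s z = {(i, j). i < n \<and> j < n \<and> 0 < s ''reach'' ((z * n + i) * n + j)}"

lemma bval_reach:
  assumes "mul_table n s" "aval z s < n" "aval i s < n" "aval j s < n"
  shows "bval (reach z i j) s \<longleftrightarrow> (aval i s, aval j s) \<in> reached n s (aval z s)"
  using aval_index3[OF assms(1-3)] assms by (simp add: reach_def reached_def)

lemma reached_set_reach:
  assumes "mul_table n s" "s ''z'' 0 = z" "s ''i'' 0 = i" "s ''j'' 0 = j" "z < n" "i < n" "j < n"
    "z' < n"
  shows "reached n (effect set_reach s) z' =
    (if z' = z then insert (i, j) (reached n s z) else reached n s z')"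
proof -
  have a: "aval (index3 (Var ''z'') (Var ''i'') (Var ''j'')) s = (z * n + i) * n + j"
    using aval_index3[OF assms(1), of "Var ''z''" "Var ''i''"] assms by simp
  have "(z' * n + p) * n + q = (z * n + i) * n + j \<longleftrightarrow> z' = z \<and> p = i \<and> q = j"
    if "p < n" "q < n" for p q
    using index3_inj[of z' n p q z i j] that assms(6,7) by auto
  then show ?thesis
    using assms(6,7) by (auto simp: reached_def set_reach_def a)
qed

definition graph_memory :: "nat pair_pre_digraph \<Rightarrow> nat \<Rightarrow> memory \<Rightarrow> bool" where
  "graph_memory G n s \<longleftrightarrow>
     (\<forall>i < n. \<forall>j < n. s ''adj'' (i * n + j) = (if (i, j) \<in> parcs G then 1 else 0))"

lemma bval_near:
  assumes "mul_table n s" "graph_memory G n s" "aval a s < n" "aval b s < n"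
  shows "bval (near a b) s \<longleftrightarrow> aval b s \<in> closed_neighborhood G (aval a s)"
proof -
  have "aval a s \<le> n * n" using assms by (meson le_square less_imp_le order_trans)
  then show ?thesis
    using assms by (auto simp: near_def mul_table_def graph_memory_def closed_neighborhood_def
      neighborhood_def)
qed

text \<open>N[i] contains \<open>i\<close>, so the relation is reflexive outside N[z]. Its
  transitive closure thus includes the one-vertex paths, and Warshall's nonempty walks
  suffice.\<close>

definition start :: "nat pair_pre_digraph \<Rightarrow> nat \<Rightarrow> nat \<Rightarrow> nat rel" where
  "start G n z = {(i, j). i < n \<and> j < n \<and> j \<in> closed_neighborhood G i \<and>
     i \<notin> closed_neighborhood G z \<and> j \<notin> closed_neighborhood G z}"

lemma reached_put [simp]: "a \<noteq> ''reach'' \<Longrightarrow> reached n (put s a m x) z = reached n s z"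
  by (simp add: reached_def)

definition environment :: "nat pair_pre_digraph \<Rightarrow> nat \<Rightarrow> memory \<Rightarrow> bool" where
  "environment G n s \<longleftrightarrow> mul_table n s \<and> graph_memory G n s"

lemma environment_put [simp]:
  "a \<notin> {''n'', ''mul'', ''adj''} \<Longrightarrow> environment G n (put s a m x) = environment G n s"
  by (auto simp: environment_def mul_table_def graph_memory_def)

text \<open>
  A sweep over all pairs adds \<open>(i, j)\<close> whenever \<open>R\<close> satisfies a monotone condition \<open>Q R i j\<close>. Since \<open>R\<close>
  changes during the sweep, it is only known to stay between \<open>W\<close> and \<open>U\<close>.
\<close>

lemma sweep:
  assumes b: "\<And>s i j. environment G n s \<Longrightarrow> s ''z'' 0 = z \<Longrightarrow> K s \<Longrightarrow> s ''i'' 0 = i \<Longrightarrow>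
      s ''j'' 0 = j \<Longrightarrow> i < n \<Longrightarrow> j < n \<Longrightarrow> bval b s \<longleftrightarrow> Q (reached n s z) i j"
    and mono: "\<And>R R' i j. Q R i j \<Longrightarrow> R \<subseteq> R' \<Longrightarrow> Q R' i j"
    and upper: "\<And>i j. Q U i j \<Longrightarrow> i < n \<Longrightarrow> j < n \<Longrightarrow> (i, j) \<in> U"
    and K: "\<And>s a m x. K s \<Longrightarrow> a \<in> {''i'', ''j'', ''reach''} \<Longrightarrow> K (put s a m x)"
    and "z < n"
  shows "hoare (\<lambda>s. environment G n s \<and> s ''z'' 0 = z \<and> K s \<and>
        (\<forall>z' < n. z' \<noteq> z \<longrightarrow> reached n s z' = L z') \<and> W \<subseteq> reached n s z \<and> reached n s z \<subseteq> U)
      (For ''i'' (Const 0) (Var ''n'') (For ''j'' (Const 0) (Var ''n'') (Cond b set_reach Skip)))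
      ((n + 1)\<^sup>2 * (bcost b + 50))
      (\<lambda>s. environment G n s \<and> s ''z'' 0 = z \<and> K s \<and>
        (\<forall>z' < n. z' \<noteq> z \<longrightarrow> reached n s z' = L z') \<and> W \<subseteq> reached n s z \<and> reached n s z \<subseteq> U \<and>
        (\<forall>i < n. \<forall>j < n. Q W i j \<longrightarrow> (i, j) \<in> reached n s z))"
    (is "hoare ?P _ _ _")
proof -
  define I where "I i s \<longleftrightarrow> ?P s \<and> (\<forall>p < i. \<forall>q < n. Q W p q \<longrightarrow> (p, q) \<in> reached n s z)" for i s
  define J where "J i j s \<longleftrightarrow> I i s \<and> s ''i'' 0 = i \<and>
    (\<forall>q < j. Q W i q \<longrightarrow> (i, q) \<in> reached n s z)" for i j s
  have n: "aval (Var ''n'') s = n" if "environment G n s" for s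
    using that by (simp add: environment_def mul_table_def)
  have cell: "hoare (\<lambda>s. J i j s \<and> s ''j'' 0 = j) (Cond b set_reach Skip) (bcost b + 24)
      (\<lambda>s. J i (Suc j) s \<and> s ''j'' 0 = j)" if "i < n" "j < n" for i j
  proof (rule hoare_simple)
    fix s assume s: "J i j s \<and> s ''j'' 0 = j"
    then have env: "environment G n s" and vars: "s ''z'' 0 = z" "s ''i'' 0 = i" "s ''j'' 0 = j" and "K s"
      and R: "W \<subseteq> reached n s z" "reached n s z \<subseteq> U"
      by (auto simp: J_def I_def)
    have bv: "bval b s \<longleftrightarrow> Q (reached n s z) i j"
      using b[OF env vars(1) \<open>K s\<close> vars(2,3)] that by simp
    show "J i (Suc j) (effect (Cond b set_reach Skip) s) \<and> effect (Cond b set_reach Skip) s ''j'' 0 = j"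
    proof (cases "bval b s")
      case False
      then have "\<not> Q W i j" using bv mono R(1) by blast
      with s False show ?thesis by (auto simp: J_def less_Suc_eq)
    next
      case True
      then have "(i, j) \<in> U" using bv mono R(2) upper that by blast
      have "mul_table n s" using env by (simp add: environment_def)
      note reached = reached_set_reach[OF this vars \<open>z < n\<close> that]
      have "effect set_reach s = put s ''reach'' (aval (index3 (Var ''z'') (Var ''i'') (Var ''j'')) s) 1"
        by (simp add: set_reach_def)
      then have "environment G n (effect set_reach s)" "K (effect set_reach s)"
        "effect set_reach s ''z'' 0 = z" "effect set_reach s ''i'' 0 = i" "effect set_reach s ''j'' 0 = j"
        using env K[OF \<open>K s\<close>] vars by auto
      then show ?thesis
        using s True \<open>(i, j) \<in> U\<close> reached \<open>z < n\<close> by (auto simp: J_def I_def less_Suc_eq)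
    qed
  qed (simp_all add: set_reach_def index3_def)
  have inner: "hoare (\<lambda>s. I i s \<and> s ''i'' 0 = i)
      (For ''j'' (Const 0) (Var ''n'') (Cond b set_reach Skip))
      (Suc (n - 0) * (bcost b + 24 + acost (Const 0) + acost (Var ''n'') + 10)) (J i n)" if "i < n" for i
  proof (rule hoare_For)
    show "aval (Var ''n'') s = n" if "J i j s" for j s
      using that n by (simp add: J_def I_def)
  qed (use cell that K in \<open>auto simp: J_def I_def\<close>)
  have outer: "hoare ?P
      (For ''i'' (Const 0) (Var ''n'') (For ''j'' (Const 0) (Var ''n'') (Cond b set_reach Skip)))
      (Suc (n - 0) * (Suc (n - 0) * (bcost b + 24 + acost (Const 0) + acost (Var ''n'') + 10) +
         acost (Const 0) + acost (Var ''n'') + 10)) (I n)"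
  proof (rule hoare_For)
    show "aval (Var ''n'') s = n" if "I i s" for i s
      using that n by (simp add: I_def)
    show "hoare (\<lambda>s. I i s \<and> s ''i'' 0 = i) (For ''j'' (Const 0) (Var ''n'') (Cond b set_reach Skip))
      (Suc (n - 0) * (bcost b + 24 + acost (Const 0) + acost (Var ''n'') + 10))
      (\<lambda>s. I (Suc i) s \<and> s ''i'' 0 = i)" if "i < n" for i
      by (rule hoare_conseq[OF inner[OF that]]) (auto simp: J_def I_def less_Suc_eq)
  qed (use K in \<open>auto simp: I_def\<close>)
  show ?thesis
  proof (rule hoare_conseq[OF outer])
    have "bcost b \<le> bcost b * Suc n" by simp
    then show "Suc (n - 0) * (Suc (n - 0) * (bcost b + 24 + acost (Const 0) + acost (Var ''n'') + 10) +
         acost (Const 0) + acost (Var ''n'') + 10) \<le> (n + 1)\<^sup>2 * (bcost b + 50)"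
      by (simp add: power2_eq_square algebra_simps)
  qed (auto simp: I_def)
qed

lemma start_subset: "start G n z \<subseteq> {..<n} \<times> {..<n}"
  by (auto simp: start_def)

lemma make_reach:
  "hoare (\<lambda>s. environment G n s \<and> (\<forall>z < n. reached n s z = {})) make_reach (1000 * (n + 1) ^ 4)
     (\<lambda>s. mul_table n s \<and> (\<forall>z < n. reached n s z = (start G n z)\<^sup>+))"
proof -
  define L where "L z z' = (if z' < z then (start G n z')\<^sup>+ else {})" for z z'
  define I where "I z s \<longleftrightarrow> environment G n s \<and> (\<forall>z' < n. reached n s z' = L z z')" for z s
  define O' where "O' z s \<longleftrightarrow> environment G n s \<and> s ''z'' 0 = z \<and>
    (\<forall>z' < n. z' \<noteq> z \<longrightarrow> reached n s z' = L z z')" for z s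
  have body: "hoare (\<lambda>s. I z s \<and> s ''z'' 0 = z)
     (Seq
       (For ''i'' (Const 0) (Var ''n'') (For ''j'' (Const 0) (Var ''n'') start_cell))
       (For ''k'' (Const 0) (Var ''n'')
         (For ''i'' (Const 0) (Var ''n'') (For ''j'' (Const 0) (Var ''n'') warshall_cell))))
     ((n + 1)\<^sup>2 * 150 + Suc (n - 0) * ((n + 1)\<^sup>2 * 150 + acost (Const 0) + acost (Var ''n'') + 10))
     (\<lambda>s. I (Suc z) s \<and> s ''z'' 0 = z)" (is "hoare _ (Seq ?A ?B) (?S + ?T) _") if "z < n"
  for z
  proof -
    let ?s = "start G n z"
    have 1: "hoare (\<lambda>s. I z s \<and> s ''z'' 0 = z) ?A ?S (\<lambda>s. O' z s \<and> reached n s z = ?s)"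
    proof (rule hoare_conseq)
      show "hoare (\<lambda>s. environment G n s \<and> s ''z'' 0 = z \<and> True \<and>
        (\<forall>z' < n. z' \<noteq> z \<longrightarrow> reached n s z' = L z z') \<and> {} \<subseteq> reached n s z \<and> reached n s z \<subseteq> ?s)
        ?A ((n + 1)\<^sup>2 * (bcost (And (near (Var ''i'') (Var ''j''))
     (And (Not (near (Var ''z'') (Var ''i''))) (Not (near (Var ''z'') (Var ''j''))))) + 50))
        (\<lambda>s. environment G n s \<and> s ''z'' 0 = z \<and> True \<and>
        (\<forall>z' < n. z' \<noteq> z \<longrightarrow> reached n s z' = L z z') \<and> {} \<subseteq> reached n s z \<and> reached n s z \<subseteq> ?s \<and>
        (\<forall>i < n. \<forall>j < n. (i, j) \<in> ?s \<longrightarrow> (i, j) \<in> reached n s z))"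
        unfolding start_cell_def
        by (rule sweep[where Q = "\<lambda>R i j. (i, j) \<in> ?s"])
          (use that in \<open>auto simp: environment_def bval_near start_def\<close>)
    qed (use that in \<open>auto simp: I_def O'_def L_def near_def start_def\<close>)
    \<comment> \<open>Updates in place may enter pairs ahead of their round, so the table is only
      sandwiched; the two bounds meet at \<open>k = n\<close>.\<close>
    define J where "J k s \<longleftrightarrow> O' z s \<and> walks ?s k \<subseteq> reached n s z \<and> reached n s z \<subseteq> ?s\<^sup>+" for k s
    have 2: "hoare (\<lambda>s. O' z s \<and> reached n s z = ?s) ?B ?T (J n)"
    proof (rule hoare_For)
      show "hoare (\<lambda>s. J k s \<and> s ''k'' 0 = k)
        (For ''i'' (Const 0) (Var ''n'') (For ''j'' (Const 0) (Var ''n'') warshall_cell))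
        ((n + 1)\<^sup>2 * 150) (\<lambda>s. J (Suc k) s \<and> s ''k'' 0 = k)" if "k < n" for k
      proof (rule hoare_conseq)
        show "hoare (\<lambda>s. environment G n s \<and> s ''z'' 0 = z \<and> s ''k'' 0 = k \<and>
          (\<forall>z' < n. z' \<noteq> z \<longrightarrow> reached n s z' = L z z') \<and> walks ?s k \<subseteq> reached n s z \<and>
            reached n s z \<subseteq> ?s\<^sup>+)
          (For ''i'' (Const 0) (Var ''n'') (For ''j'' (Const 0) (Var ''n'') warshall_cell))
          ((n + 1)\<^sup>2 * (bcost (And (reach (Var ''z'') (Var ''i'') (Var ''k''))
             (reach (Var ''z'') (Var ''k'') (Var ''j''))) + 50))
          (\<lambda>s. environment G n s \<and> s ''z'' 0 = z \<and> s ''k'' 0 = k \<and>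
          (\<forall>z' < n. z' \<noteq> z \<longrightarrow> reached n s z' = L z z') \<and> walks ?s k \<subseteq> reached n s z \<and>
            reached n s z \<subseteq> ?s\<^sup>+ \<and> (\<forall>i < n. \<forall>j < n. (i, k) \<in> walks ?s k \<and> (k, j) \<in> walks ?s k \<longrightarrow>
              (i, j) \<in> reached n s z))"
          unfolding warshall_cell_def
          by (rule sweep[where Q = "\<lambda>R i j. (i, k) \<in> R \<and> (k, j) \<in> R"])
            (use \<open>z < n\<close> that in \<open>auto simp: environment_def bval_reach intro: trancl_trans\<close>)
        have "walks ?s k \<subseteq> {..<n} \<times> {..<n}"
          using walks_subset_trancl[of ?s k] trancl_mono_subset[OF start_subset] trancl_subset_Sigma
          by (metis start_subset subset_trans)
        then have lt: "i < n" "j < n" if "(i, j) \<in> walks ?s k" for i j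
          using that by auto
        show "J (Suc k) s \<and> s ''k'' 0 = k"
          if "environment G n s \<and> s ''z'' 0 = z \<and> s ''k'' 0 = k \<and>
          (\<forall>z' < n. z' \<noteq> z \<longrightarrow> reached n s z' = L z z') \<and> walks ?s k \<subseteq> reached n s z \<and>
            reached n s z \<subseteq> ?s\<^sup>+ \<and> (\<forall>i < n. \<forall>j < n. (i, k) \<in> walks ?s k \<and> (k, j) \<in> walks ?s k \<longrightarrow>
              (i, j) \<in> reached n s z)" for s
        proof -
          have "walks ?s (Suc k) \<subseteq> reached n s z"
            using that lt by auto
          with that show ?thesis by (simp add: J_def O'_def)
        qed
      qed (auto simp: J_def O'_def reach_def index3_def)
    qed (auto simp: J_def O'_def environment_def mul_table_def graph_memory_def)
    show ?thesis
    proof (rule hoare_conseq[OF hoare_Seq[OF 1 2]])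
      show "I (Suc z) s \<and> s ''z'' 0 = z" if "J n s" for s
        using that walks_eq_trancl[OF start_subset, of G n z]
        by (auto simp: I_def J_def O'_def L_def less_Suc_eq)
    qed auto
  qed
  have outer: "hoare (\<lambda>s. environment G n s \<and> (\<forall>z < n. reached n s z = {})) make_reach
     (Suc (n - 0) * ((n + 1)\<^sup>2 * 150 + Suc (n - 0) * ((n + 1)\<^sup>2 * 150 + acost (Const 0) + acost (Var ''n'') + 10)
       + acost (Const 0) + acost (Var ''n'') + 10)) (I n)"
    unfolding make_reach_def
    by (rule hoare_For)
      (use body in \<open>auto simp: I_def L_def environment_def mul_table_def graph_memory_def\<close>)
  show ?thesis
  proof (rule hoare_conseq[OF outer])
    show "Suc (n - 0) * ((n + 1)\<^sup>2 * 150 + Suc (n - 0) * ((n + 1)\<^sup>2 * 150 + acost (Const 0) + acost (Var ''n'') + 10)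
       + acost (Const 0) + acost (Var ''n'') + 10) \<le> 1000 * (n + 1) ^ 4"
      by (simp add: power2_eq_square power4_eq_xxxx algebra_simps)
  qed (auto simp: I_def L_def environment_def)
qed

section \<open>The backtracking search\<close>

definition depth :: aexp where
  "depth = Minus (Var ''D'') (Const 1)"

definition current :: aexp where
  "current = Load ''pos'' depth"

definition between_test :: bexp where
  "between_test = And
     (reach (Load ''out'' (Var ''y'')) (Load ''out'' current) (Load ''out'' (Var ''x'')))
     (reach (Load ''out'' (Var ''x'')) (Load ''out'' current) (Load ''out'' (Var ''y'')))"

definition check :: com where
  "check = Seq (Assign ''flag'' (Const 1))
     (For ''x'' depth (Var ''n'') (For ''y'' depth (Var ''n'')
       (Cond between_test (Assign ''flag'' (Const 0)) Skip)))"

definition swap :: com where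
  "swap = Seq (Assign ''t'' (Load ''out'' depth))
     (Seq (Store ''out'' depth (Load ''out'' current)) (Store ''out'' current (Var ''t'')))"

definition descend :: com where
  "descend = Seq swap (Seq (Assign ''D'' (Plus (Var ''D'') (Const 1))) (Store ''pos'' depth depth))"

definition advance :: com where
  "advance = Store ''pos'' depth (Plus current (Const 1))"

text \<open>
  Leaving depth 0 sets \<open>D\<close> to 0. The truncated subtraction in \<open>depth\<close> then yields 0 and the swap
  spoils \<open>out\<close>, which is harmless because the search is over.
\<close>

definition retreat :: com where
  "retreat = Seq (Assign ''D'' (Minus (Var ''D'') (Const 1))) (Seq swap advance)"

text \<open>Each iteration either tests one candidate or leaves a node. \<open>descend\<close>
  starts a new depth at its own index, so at depth \<open>n\<close> the candidates are exhausted at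
  once and a leaf goes straight to \<open>Emit\<close>.\<close>

definition search_step :: com where
  "search_step = Cond (Less current (Var ''n''))
     (Seq check (Cond (Less (Const 0) (Var ''flag'')) descend advance))
     (Seq (Cond (Less depth (Var ''n'')) Skip Emit) retreat)"

definition running :: bexp where
  "running = Less (Const 0) (Var ''D'')"

section \<open>Invariants of the search loop and its outputs\<close>

lemma comp_transpose_eq_upd: "f \<circ> transpose d i = f(d := f i, i := f d)"
  by (auto simp: fun_eq_iff transpose_def)

locale search =
  fixes n :: nat and R :: "nat \<Rightarrow> nat rel"
begin

definition E :: "nat \<Rightarrow> nat set \<Rightarrow> bool" where
  "E z S \<longleftrightarrow> (\<forall>x\<in>S. \<forall>y\<in>S. \<not> ((z, x) \<in> R y \<and> (z, y) \<in> R x))"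

definition tables :: "memory \<Rightarrow> bool" where
  "tables s \<longleftrightarrow> mul_table n s \<and> (\<forall>z < n. reached n s z = R z)"

lemma tables_put [simp]: "a \<notin> {''n'', ''mul'', ''reach''} \<Longrightarrow> tables (put s a m x) = tables s"
  by (auto simp: tables_def mul_table_def)

text \<open>
  The search is at depth \<open>d\<close>: the cells \<open>0, \<dots>, d - 1\<close> of \<open>f\<close> hold the chosen vertices, the other ones
  hold the remaining vertices, and \<open>p d\<close> is the position of the next candidate for cell \<open>d\<close>.
  The variable \<open>D\<close> is \<open>d + 1\<close>, so that 0 can signal the end of the search.
\<close>

definition node :: "(nat \<Rightarrow> nat) \<Rightarrow> nat \<Rightarrow> (nat \<Rightarrow> nat) \<Rightarrow> memory \<Rightarrow> bool" where
  "node f d p s \<longleftrightarrow> tables s \<and> s ''D'' 0 = Suc d \<and> s ''pos'' = p \<and> s ''out'' = f"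

lemma node_put [simp]:
  "a \<notin> {''n'', ''mul'', ''reach'', ''D'', ''pos'', ''out''} \<Longrightarrow> node f d p (put s a m x) = node f d p s"
  by (auto simp: node_def)

lemma node_n: "node f d p s \<Longrightarrow> s ''n'' 0 = n"
  by (simp add: node_def tables_def mul_table_def)

lemma node_depth: "node f d p s \<Longrightarrow> aval depth s = d"
  by (simp add: node_def depth_def)

lemma node_current: "node f d p s \<Longrightarrow> aval current s = p d"
  by (simp add: current_def node_depth) (simp add: node_def)

abbreviation valid :: "(nat \<Rightarrow> nat) \<Rightarrow> bool" where
  "valid f \<equiv> \<forall>i < n. f i < n"

lemma node_between_test:
  assumes "node f d p s" "valid f" "p d < n" "s ''x'' 0 = x" "s ''y'' 0 = y" "x < n" "y < n"
  shows "bval between_test s \<longleftrightarrow> (f (p d), f x) \<in> R (f y) \<and> (f (p d), f y) \<in> R (f x)"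
proof -
  have "f (p d) < n" "f x < n" "f y < n" using assms by auto
  moreover have "s ''out'' = f" "mul_table n s" "\<And>z. z < n \<Longrightarrow> reached n s z = R z"
    using assms(1) by (auto simp: node_def tables_def)
  ultimately show ?thesis
    using node_current[OF assms(1)] assms(4,5) by (simp add: between_test_def bval_reach)
qed

text \<open>Both loops start at \<open>depth\<close>, so the time bound involves only the
  \<open>Suc k\<close> unplaced vertices; the leaves below a deep node could not pay for a bound in
  \<open>n\<close>.\<close>

lemma check:
  assumes "valid f" "p d < n" "n - d = Suc k"
  shows "hoare (node f d p) check (200 * (k + 3)\<^sup>2)
    (\<lambda>s. node f d p s \<and> (0 < s ''flag'' 0 \<longleftrightarrow> E (f (p d)) (f ` {d..<n})))"
proof -
  define bad where "bad x y \<longleftrightarrow> (f (p d), f x) \<in> R (f y) \<and> (f (p d), f y) \<in> R (f x)" for x y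
  have "d \<le> n" using assms by simp
  define I where "I a s \<longleftrightarrow> node f d p s \<and> (s ''flag'' 0 = 0 \<longleftrightarrow> (\<exists>x\<in>{d..<a}. \<exists>y\<in>{d..<n}. bad x y))"
    for a s
  define J where "J a b s \<longleftrightarrow> node f d p s \<and> s ''x'' 0 = a \<and> (s ''flag'' 0 = 0 \<longleftrightarrow>
    (\<exists>x\<in>{d..<a}. \<exists>y\<in>{d..<n}. bad x y) \<or> (\<exists>y\<in>{d..<b}. bad a y))" for a b s
  have inner: "hoare (\<lambda>s. I a s \<and> s ''x'' 0 = a)
      (For ''y'' depth (Var ''n'') (Cond between_test (Assign ''flag'' (Const 0)) Skip))
      (Suc (n - d) * (70 + acost depth + acost (Var ''n'') + 10)) (J a n)" if "d \<le> a" "a < n" for a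
  proof (rule hoare_For)
    show "hoare (\<lambda>s. J a b s \<and> s ''y'' 0 = b) (Cond between_test (Assign ''flag'' (Const 0)) Skip) 70
      (\<lambda>s. J a (Suc b) s \<and> s ''y'' 0 = b)" if "d \<le> b" "b < n" for b
    proof (rule hoare_simple)
      show "J a (Suc b) (effect (Cond between_test (Assign ''flag'' (Const 0)) Skip) s) \<and>
        effect (Cond between_test (Assign ''flag'' (Const 0)) Skip) s ''y'' 0 = b"
        if s: "J a b s \<and> s ''y'' 0 = b" for s
      proof -
        have "bval between_test s \<longleftrightarrow> bad a b"
          unfolding bad_def using node_between_test[of f d p s a b] assms(1,2) s \<open>a < n\<close> \<open>b < n\<close>
          by (simp add: J_def)
        moreover have "{d..<Suc b} = insert b {d..<b}" using \<open>d \<le> b\<close> by auto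
        ultimately show ?thesis using s by (auto simp: J_def)
      qed
    qed (simp_all add: between_test_def reach_def index3_def current_def depth_def)
  qed (use \<open>d \<le> n\<close> in \<open>auto simp: I_def J_def node_depth node_n\<close>)
  have outer: "hoare (I d)
      (For ''x'' depth (Var ''n'') (For ''y'' depth (Var ''n'')
        (Cond between_test (Assign ''flag'' (Const 0)) Skip)))
      (Suc (n - d) * (Suc (n - d) * (70 + acost depth + acost (Var ''n'') + 10) +
        acost depth + acost (Var ''n'') + 10)) (I n)"
  proof (rule hoare_For)
    show "hoare (\<lambda>s. I a s \<and> s ''x'' 0 = a)
      (For ''y'' depth (Var ''n'') (Cond between_test (Assign ''flag'' (Const 0)) Skip))
      (Suc (n - d) * (70 + acost depth + acost (Var ''n'') + 10)) (\<lambda>s. I (Suc a) s \<and> s ''x'' 0 = a)"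
      if "d \<le> a" "a < n" for a
    proof (rule hoare_conseq[OF inner[OF that]])
      have "{d..<Suc a} = insert a {d..<a}" using \<open>d \<le> a\<close> by auto
      then show "I (Suc a) s \<and> s ''x'' 0 = a" if "J a n s" for s
        using that by (auto simp: I_def J_def)
    qed auto
  qed (use \<open>d \<le> n\<close> in \<open>auto simp: I_def node_depth node_n\<close>)
  have flag: "hoare (node f d p) (Assign ''flag'' (Const 1)) 3 (I d)"
    by (rule hoare_simple) (auto simp: I_def)
  show ?thesis unfolding check_def
  proof (rule hoare_conseq[OF hoare_Seq[OF flag outer]])
    show "node f d p s \<and> (0 < s ''flag'' 0 \<longleftrightarrow> E (f (p d)) (f ` {d..<n}))" if "I n s" for s
      using that by (auto simp: I_def E_def bad_def)
    show "3 + Suc (n - d) * (Suc (n - d) * (70 + acost depth + acost (Var ''n'') + 10) +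
        acost depth + acost (Var ''n'') + 10) \<le> 200 * (k + 3)\<^sup>2"
      unfolding assms(3) by (simp add: depth_def power2_eq_square algebra_simps)
  qed
qed

lemma descend:
  assumes "node f d p s"
  shows "node (f \<circ> transpose d (p d)) (Suc d) (p(Suc d := Suc d)) (effect descend s)"
  using assms
  by (simp add: descend_def swap_def current_def depth_def node_def comp_transpose_eq_upd fun_eq_iff)

lemma advance:
  assumes "node f d p s"
  shows "node f d (p(d := Suc (p d))) (effect advance s)"
  using assms by (simp add: advance_def current_def depth_def node_def)

text \<open>Here \<open>f\<close> is the child's array. The entry \<open>p d\<close> still holds the
  parent's candidate, and transpositions are involutions, so repeating the swap restores the
  parent's array.\<close>

lemma retreat:
  assumes "node f (Suc d) p s"
  shows "node (f \<circ> transpose d (p d)) d (p(d := Suc (p d))) (effect retreat s)"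
  using assms
  by (simp add: retreat_def advance_def swap_def current_def depth_def node_def comp_transpose_eq_upd fun_eq_iff)

lemma iter_candidate:
  assumes "node f d p s" "valid f" "p d < n" "n - d = Suc k"
  defines "e \<equiv> E (f (p d)) (f ` {d..<n})"
  obtains t s' where "iter running search_step s t [] s'" "t \<le> 1000 * (k + 3)\<^sup>2"
    "e \<Longrightarrow> node (f \<circ> transpose d (p d)) (Suc d) (p(Suc d := Suc d)) s'"
    "\<not> e \<Longrightarrow> node f d (p(d := Suc (p d))) s'"
proof -
  obtain t1 s1 where 1: "exec check s t1 [] s1" "t1 \<le> 200 * (k + 3)\<^sup>2"
      "node f d p s1 \<and> (0 < s1 ''flag'' 0 \<longleftrightarrow> e)"
    unfolding e_def using hoareD[where P = "node f d p", OF check[of f p d k, OF assms(2-4)] assms(1)] .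
  let ?c = "Cond (Less (Const 0) (Var ''flag'')) descend advance"
  have "simple ?c" by (simp add: descend_def advance_def swap_def)
  then obtain t2 where 2: "t2 \<le> ccost ?c" "exec ?c s1 t2 [] (effect ?c s1)"
    using exec_simple by metis
  have "ccost ?c \<le> 100"
    by (simp add: descend_def advance_def swap_def current_def depth_def)
  with 2 have "t2 \<le> 100" by simp
  have "bval (Less current (Var ''n'')) s"
    using assms(3) node_current[OF assms(1)] node_n[OF assms(1)] by simp
  then have "exec search_step s (1 + bcost (Less current (Var ''n'')) + (t1 + t2)) ([] @ []) (effect ?c s1)"
    unfolding search_step_def by (rule exec.CondTrue[OF _ exec.Seq[OF 1(1) 2(2)]])
  moreover have "bval running s" using assms(1) by (simp add: running_def node_def)
  ultimately have "iter running search_step s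
      (1 + bcost running + (1 + bcost (Less current (Var ''n'')) + (t1 + t2))) [] (effect ?c s1)"
    using iter_single by fastforce
  moreover have "1 + bcost running + (1 + bcost (Less current (Var ''n'')) + (t1 + t2)) \<le> 1000 * (k + 3)\<^sup>2"
  proof -
    have "1 \<le> (k + 3)\<^sup>2" by simp
    moreover have "1 + bcost running + (1 + bcost (Less current (Var ''n''))) \<le> 100"
      by (simp add: running_def current_def depth_def)
    ultimately show ?thesis using 1(2) \<open>t2 \<le> 100\<close> by linarith
  qed
  ultimately show ?thesis
    using that descend[of f d p s1] advance[of f d p s1] 1(3) by (auto split: if_splits)
qed

lemma iter_exhausted:
  assumes "node f d p s" "n \<le> p d" "d \<le> n"
  obtains t where "iter running search_step s t (if d = n then [f] else []) (effect retreat s)" "t \<le> 1000"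
proof -
  let ?c = "Cond (Less depth (Var ''n'')) Skip Emit"
  have 1: "exec ?c s (1 + bcost (Less depth (Var ''n'')) + 1) (if d = n then [f] else []) s"
  proof (cases "d = n")
    case True
    then have less: "\<not> bval (Less depth (Var ''n'')) s"
      using node_depth[OF assms(1)] node_n[OF assms(1)] by simp
    have "s ''out'' = f" using assms(1) by (simp add: node_def)
    then show ?thesis using exec.CondFalse[OF less exec.Emit, of Skip] True by simp
  next
    case False
    then have less: "bval (Less depth (Var ''n'')) s"
      using node_depth[OF assms(1)] node_n[OF assms(1)] assms(3) by simp
    show ?thesis using exec.CondTrue[OF less exec.Skip, of Emit] False by simp
  qed
  have "simple retreat" by (simp add: retreat_def swap_def advance_def)
  then obtain t2 where 2: "t2 \<le> ccost retreat" "exec retreat s t2 [] (effect retreat s)"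
    using exec_simple by metis
  have "ccost retreat \<le> 100"
    by (simp add: retreat_def advance_def swap_def current_def depth_def)
  with 2 have "t2 \<le> 100" by simp
  have "\<not> bval (Less current (Var ''n'')) s"
    using assms(2) node_current[OF assms(1)] node_n[OF assms(1)] by simp
  then have "exec search_step s (1 + bcost (Less current (Var ''n'')) +
      ((1 + bcost (Less depth (Var ''n'')) + 1) + t2)) ((if d = n then [f] else []) @ []) (effect retreat s)"
    unfolding search_step_def by (rule exec.CondFalse[OF _ exec.Seq[OF 1 2(2)]])
  moreover have "bval running s" using assms(1) by (simp add: running_def node_def)
  ultimately have "iter running search_step s (1 + bcost running + (1 + bcost (Less current (Var ''n'')) +
      ((1 + bcost (Less depth (Var ''n'')) + 1) + t2))) (if d = n then [f] else []) (effect retreat s)"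
    using iter_single by fastforce
  moreover have "1 + bcost running + (1 + bcost (Less current (Var ''n'')) +
      ((1 + bcost (Less depth (Var ''n'')) + 1) + t2)) \<le> 1000"
    using \<open>t2 \<le> 100\<close> by (simp add: running_def current_def depth_def)
  ultimately show ?thesis using that by blast
qed

lemma valid_comp_transpose:
  assumes "valid f" "d < n" "i < n"
  shows "valid (f \<circ> transpose d i)"
  using assms by (auto simp: transpose_def)

text \<open>The segment stops just before the iteration that leaves the node, which is left to the
  parent. A leaf emits in that very iteration, which explains the extra \<open>[f]\<close> for
  \<open>k = 0\<close>, and the 1000 reserves its time. Array and lower stack entries come back
  unchanged, so that the parent can continue.\<close>

lemma iter_subtree:
  assumes "node f d p s" "valid f" "p d = d" "d + k = n"
  shows "\<exists>t os s' p'. iter running search_step s t os s' \<and> node f d p' s' \<and> p' d = n \<and>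
    (\<forall>j < d. p' j = p j) \<and> os @ (if k = 0 then [f] else []) = gen E n k f \<and>
    t + 1000 \<le> gen_cost E n 1000 k f"
  using assms
proof (induction k arbitrary: d f p s)
  case 0
  then show ?case using iter_refl[of running search_step s]
    by (intro exI[of _ 0] exI[of _ "[]"] exI[of _ s] exI[of _ p]) simp
next
  case (Suc k)
  define e where "e i \<longleftrightarrow> E (f i) (f ` {d..<n})" for i
  define g where "g i = gen E n k (f \<circ> transpose d i)" for i
  define c where "c i = gen_cost E n 1000 k (f \<circ> transpose d i)" for i
  have d: "d < n" "n - d = Suc k" "n - Suc k = d" using Suc.prems by auto
  \<comment> \<open>The remaining part of the loop over the children, by downward induction on the
    next candidate position \<open>i\<close>; the entries of the stack beyond \<open>d\<close> are
    arbitrary.\<close>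
  have scan: "\<exists>t s' p'. iter running search_step s t (concat (map g (filter e [i..<n]))) s' \<and>
      node f d p' s' \<and> p' d = n \<and> (\<forall>j < d. p' j = p j) \<and>
      t \<le> (n - i) * (1000 * (k + 3)\<^sup>2) + sum_list (map c (filter e [i..<n]))"
    if "d \<le> i" "i \<le> n" "node f d p s" "p d = i" for i p s
    using \<open>i \<le> n\<close> that(1,3,4)
  proof (induction arbitrary: p s rule: inc_induct)
    case base
    then show ?case using iter_refl[of running search_step s]
      by (intro exI[of _ 0] exI[of _ s] exI[of _ p]) simp
  next
    case (step i)
    have n_i: "n - i = Suc (n - Suc i)" and upt: "[i..<n] = i # [Suc i..<n]"
      using step by (auto simp: upt_conv_Cons)
    obtain t1 s1 where 1: "iter running search_step s t1 [] s1" "t1 \<le> 1000 * (k + 3)\<^sup>2"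
      "e i \<Longrightarrow> node (f \<circ> transpose d i) (Suc d) (p(Suc d := Suc d)) s1"
      "\<not> e i \<Longrightarrow> node f d (p(d := Suc i)) s1"
    proof (rule iter_candidate[OF step.prems(2) Suc.prems(2) _ d(2)])
      show "p d < n" using step by simp
    qed (use step.prems(3) in \<open>simp add: e_def\<close>)
    show ?case
    proof (cases "e i")
      case False
      obtain t2 s2 p2 where 2: "iter running search_step s1 t2 (concat (map g (filter e [Suc i..<n]))) s2"
        "node f d p2 s2" "p2 d = n" "\<forall>j < d. p2 j = (p(d := Suc i)) j"
        "t2 \<le> (n - Suc i) * (1000 * (k + 3)\<^sup>2) + sum_list (map c (filter e [Suc i..<n]))"
        using step.IH[OF le_SucI[OF step.prems(1)] 1(4)[OF False] fun_upd_same] by blast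
      have "iter running search_step s (t1 + t2) (concat (map g (filter e [i..<n]))) s2"
        using iter_trans[OF 1(1) 2(1)] False by (simp add: upt)
      moreover have "t1 + t2 \<le> (n - i) * (1000 * (k + 3)\<^sup>2) + sum_list (map c (filter e [i..<n]))"
        using 1(2) 2(5) False by (simp add: upt n_i)
      moreover have "\<forall>j < d. p2 j = p j" using 2(4) by simp
      ultimately show ?thesis using 2(2,3) by blast
    next
      case True
      have "valid (f \<circ> transpose d i)"
        using Suc.prems(2) d(1) step.hyps by (intro valid_comp_transpose) auto
      then obtain t2 os s2 p2 where 2: "iter running search_step s1 t2 os s2"
        "node (f \<circ> transpose d i) (Suc d) p2 s2" "p2 (Suc d) = n" "\<forall>j < Suc d. p2 j = (p(Suc d := Suc d)) j"
        "os @ (if k = 0 then [f \<circ> transpose d i] else []) = g i" "t2 + 1000 \<le> c i"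
        using Suc.IH[OF 1(3)[OF True] _ fun_upd_same] Suc.prems(4) unfolding g_def c_def add_Suc_shift
        by blast
      have "p2 d = i" using 2(4) step.prems by simp
      define s3 where "s3 = effect retreat s2"
      obtain t3 where 3: "t3 \<le> 1000" "iter running search_step s2 t3
          (if Suc d = n then [f \<circ> transpose d i] else []) s3"
        unfolding s3_def by (rule iter_exhausted[OF 2(2)]) (use 2(3) d(1) in auto)
      have "node (f \<circ> transpose d i \<circ> transpose d i) d (p2(d := Suc i)) s3"
        using retreat[OF 2(2)] \<open>p2 d = i\<close> unfolding s3_def by simp
      then have s3: "node f d (p2(d := Suc i)) s3" by (simp add: comp_assoc)
      obtain t4 s4 p4 where 4: "iter running search_step s3 t4 (concat (map g (filter e [Suc i..<n]))) s4"
        "node f d p4 s4" "p4 d = n" "\<forall>j < d. p4 j = (p2(d := Suc i)) j"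
        "t4 \<le> (n - Suc i) * (1000 * (k + 3)\<^sup>2) + sum_list (map c (filter e [Suc i..<n]))"
        using step.IH[OF le_SucI[OF step.prems(1)] s3 fun_upd_same] by blast
      have "Suc d = n \<longleftrightarrow> k = 0" using d by auto
      then have "os @ (if Suc d = n then [f \<circ> transpose d i] else []) = g i" using 2(5) by simp
      then have "iter running search_step s (t1 + (t2 + (t3 + t4))) (concat (map g (filter e [i..<n]))) s4"
        using iter_trans[OF 1(1) iter_trans[OF 2(1) iter_trans[OF 3(2) 4(1)]]] True
        by (simp add: upt flip: append_assoc)
      moreover have "t1 + (t2 + (t3 + t4)) \<le>
          (n - i) * (1000 * (k + 3)\<^sup>2) + sum_list (map c (filter e [i..<n]))"
        using 1(2) 2(6) 3(1) 4(5) True by (simp add: upt n_i)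
      moreover have "\<forall>j < d. p4 j = p j" using 2(4) 4(4) by simp
      ultimately show ?thesis using 4(2,3) by blast
    qed
  qed
  obtain t s' p' where s': "iter running search_step s t (concat (map g (filter e [d..<n]))) s'"
    "node f d p' s'" "p' d = n" "\<forall>j < d. p' j = p j"
    "t \<le> (n - d) * (1000 * (k + 3)\<^sup>2) + sum_list (map c (filter e [d..<n]))"
    using scan[OF order_refl _ Suc.prems(1,3)] d(1) by (metis less_imp_le)
  have "concat (map g (filter e [d..<n])) @ (if Suc k = 0 then [f] else []) = gen E n (Suc k) f"
    by (simp add: d(3) g_def[abs_def] e_def[abs_def])
  moreover have "t + 1000 \<le> gen_cost E n 1000 (Suc k) f"
    using s'(5) by (simp add: d(2,3) c_def[abs_def] e_def[abs_def])
  ultimately show ?case using s'(1-4) by blast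
qed

text \<open>One more iteration leaves the root and sets \<open>D\<close> to 0, paid for by the
  reserved 1000; the 5 steps are the final loop test.\<close>

lemma exec_search:
  assumes "node f 0 p s" "valid f" "p 0 = 0"
  shows "\<exists>t s'. exec (While running search_step) s t (gen E n n f) s' \<and>
    t \<le> gen_cost E n 1000 n f + 5"
proof -
  obtain t1 os s1 p1 where 1: "iter running search_step s t1 os s1" "node f 0 p1 s1" "p1 0 = n"
    "os @ (if n = 0 then [f] else []) = gen E n n f" "t1 + 1000 \<le> gen_cost E n 1000 n f"
    using iter_subtree[OF assms, of n] by auto
  obtain t2 where 2: "t2 \<le> 1000"
      "iter running search_step s1 t2 (if 0 = n then [f] else []) (effect retreat s1)"
    using iter_exhausted[OF 1(2)] 1(3) by auto
  have "iter running search_step s (t1 + t2) (gen E n n f) (effect retreat s1)"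
    using iter_trans[OF 1(1) 2(2)] 1(4) by (simp add: eq_commute[of 0])
  moreover have "\<not> bval running (effect retreat s1)"
    using 1(2) by (simp add: running_def retreat_def swap_def advance_def node_def)
  ultimately have "exec (While running search_step) s (t1 + t2 + 1 + bcost running) (gen E n n f)
      (effect retreat s1)"
    by (rule iter_While)
  moreover have "t1 + t2 + 1 + bcost running \<le> gen_cost E n 1000 n f + 5"
    using 1(5) 2(1) by (simp add: running_def)
  ultimately show ?thesis by blast
qed

end

section \<open>AT-free orders as outputs of the search\<close>

definition order_of_fun :: "nat \<Rightarrow> (nat \<Rightarrow> nat) \<Rightarrow> nat rel" where
  "order_of_fun n g = {(g i, g j) | i j. i \<le> j \<and> j < n}"

lemma order_of_list_map: "order_of_list (map g [0..<n]) = order_of_fun n g"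
proof -
  have "(map g [0..<n] ! i, map g [0..<n] ! j) = (g i, g j)" if "i \<le> j" "j < n" for i j
    using that by simp
  then show ?thesis
    unfolding order_of_list_def order_of_fun_def length_map length_upt diff_zero
    by (intro Collect_cong ex_cong1) auto
qed

lemma in_order_of_fun:
  assumes "inj_on g {..<n}" "i < n" "j < n"
  shows "(g i, g j) \<in> order_of_fun n g \<longleftrightarrow> i \<le> j"
proof
  assume "(g i, g j) \<in> order_of_fun n g"
  then obtain a b where "g i = g a" "g j = g b" "a \<le> b" "b < n" by (auto simp: order_of_fun_def)
  then have "a = i" "b = j" using inj_onD[OF assms(1), of _ a] inj_onD[OF assms(1), of _ b] assms by auto
  with \<open>a \<le> b\<close> show "i \<le> j" by simp
qed (use assms in \<open>auto simp: order_of_fun_def\<close>)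

lemma linear_order_of_fun:
  assumes "inj_on g {..<n}" "g ` {..<n} = {..<n}"
  shows "linear_order_on {..<n} (order_of_fun n g)"
proof -
  note iff = in_order_of_fun[OF assms(1)]
  have index: "\<exists>i < n. x = g i" if "x < n" for x
    using that assms(2) by (metis imageE lessThan_iff)
  have sub: "order_of_fun n g \<subseteq> {..<n} \<times> {..<n}"
    using assms(2) by (auto simp: order_of_fun_def)
  have "refl_on {..<n} (order_of_fun n g)"
    using index iff by (auto simp: refl_on_def)
  moreover have "trans (order_of_fun n g)"
  proof (rule transI)
    fix x y z assume xyz: "(x, y) \<in> order_of_fun n g" "(y, z) \<in> order_of_fun n g"
    then obtain i j k where "x = g i" "y = g j" "z = g k" "i < n" "j < n" "k < n"
      using sub index by (meson SigmaD1 SigmaD2 lessThan_iff subsetD)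
    with xyz show "(x, z) \<in> order_of_fun n g" by (simp add: iff)
  qed
  moreover have "antisym (order_of_fun n g)"
  proof (rule antisymI)
    fix x y assume xy: "(x, y) \<in> order_of_fun n g" "(y, x) \<in> order_of_fun n g"
    then obtain i j where "x = g i" "y = g j" "i < n" "j < n"
      using sub index by (meson SigmaD1 SigmaD2 lessThan_iff subsetD)
    with xy show "x = y" by (simp add: iff)
  qed
  moreover have "total_on {..<n} (order_of_fun n g)"
    unfolding total_on_def using index iff by (metis lessThan_iff nle_le)
  ultimately show ?thesis
    using sub by (simp add: linear_order_on_def partial_order_on_def preorder_on_def)
qed

text \<open>The position is recovered from the relation: \<open>g j\<close> has exactly
  \<open>Suc j\<close> predecessors, counting itself.\<close>

lemma order_of_fun_inj:
  assumes "inj_on g {..<n}" "g ` {..<n} = {..<n}" "inj_on h {..<n}" "h ` {..<n} = {..<n}"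
    and eq: "order_of_fun n g = order_of_fun n h" and "j < n"
  shows "g j = h j"
proof -
  have card: "card {y. (y, g j) \<in> order_of_fun n g} = Suc j" if "inj_on g {..<n}" "j < n" for g j
  proof -
    have "y \<in> g ` {..j}" if y: "(y, g j) \<in> order_of_fun n g" for y
    proof -
      from y obtain a b where "y = g a" "a \<le> b" "b < n" by (auto simp: order_of_fun_def)
      moreover from this y have "a \<le> j"
        using in_order_of_fun[OF \<open>inj_on g {..<n}\<close>, of a j] \<open>j < n\<close> by simp
      ultimately show ?thesis by auto
    qed
    then have "{y. (y, g j) \<in> order_of_fun n g} = g ` {..j}"
      using that by (auto simp: order_of_fun_def)
    moreover have "inj_on g {..j}" using that by (auto intro: inj_on_subset)
    ultimately show ?thesis by (simp add: card_image)
  qed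
  have "g j < n" using assms by auto
  then obtain j' where j': "j' < n" "g j = h j'" using assms(4) by (metis imageE lessThan_iff)
  have "Suc j = Suc j'"
    using card[OF assms(1) \<open>j < n\<close>] card[OF assms(3) \<open>j' < n\<close>] eq j'(2) by simp
  with j' show ?thesis by simp
qed

text \<open>The position of an element in a finite linear order is the number of its predecessors.\<close>

lemma exists_order_of_fun:
  assumes "linear_order_on {..<n} r"
  obtains g where "inj_on g {..<n}" "g ` {..<n} = {..<n}" "order_of_fun n g = r"
proof -
  have r: "r \<subseteq> {..<n} \<times> {..<n}" "refl_on {..<n} r" "trans r" "antisym r" "total_on {..<n} r"
    using assms by (auto simp: linear_order_on_def partial_order_on_def preorder_on_def)
  define L where "L z = {y. (y, z) \<in> r \<and> y \<noteq> z}" for z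
  define rank where "rank z = card (L z)" for z
  have L: "L z \<subseteq> {..<n} - {z}" for z using r(1) by (auto simp: L_def)
  have fin: "finite (L z)" for z by (rule finite_subset[OF L]) simp
  have rank_less: "rank z < n" if "z < n" for z
  proof -
    have "rank z \<le> card ({..<n} - {z})" unfolding rank_def by (rule card_mono[OF _ L]) simp
    with that show ?thesis by simp
  qed
  have mono: "rank z < rank w" if "(z, w) \<in> r" "z \<noteq> w" for z w
  proof -
    have "L z \<subseteq> L w"
      using that r(3,4) by (auto simp: L_def dest: transD antisymD)
    moreover have "z \<in> L w - L z" using that by (simp add: L_def)
    ultimately have "L z \<subset> L w" by blast
    then show ?thesis unfolding rank_def by (rule psubset_card_mono[OF fin])
  qed
  have inj: "inj_on rank {..<n}"
  proof (rule inj_onI, rule ccontr)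
    fix x y assume xy: "x \<in> {..<n}" "y \<in> {..<n}" "rank x = rank y" "x \<noteq> y"
    then have "(x, y) \<in> r \<or> (y, x) \<in> r" using r(5) by (simp add: total_on_def)
    then show False using mono[of x y] mono[of y x] xy by auto
  qed
  have "rank ` {..<n} \<subseteq> {..<n}" using rank_less by auto
  then have surj: "rank ` {..<n} = {..<n}" by (intro endo_inj_surj[OF _ _ inj]) auto
  define g where "g = inv_into {..<n} rank"
  have "bij_betw g {..<n} {..<n}"
    unfolding g_def using inj surj by (intro bij_betw_inv_into) (simp add: bij_betw_def)
  then have g: "inj_on g {..<n}" "g ` {..<n} = {..<n}" by (auto simp: bij_betw_def)
  have rank_g: "rank (g i) = i" if "i < n" for i
    unfolding g_def using surj that by (intro f_inv_into_f) auto
  have g_rank: "g (rank z) = z" if "z < n" for z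
    unfolding g_def using inj that by (intro inv_into_f_f) auto
  have "order_of_fun n g = r"
  proof (intro set_eqI iffI; clarify)
    fix x y assume "(x, y) \<in> order_of_fun n g"
    then obtain i j where ij: "x = g i" "y = g j" "i \<le> j" "j < n" by (auto simp: order_of_fun_def)
    then have "x < n" "y < n" using g(2) by auto
    moreover have "\<not> ((y, x) \<in> r \<and> y \<noteq> x)" using mono[of y x] ij rank_g by auto
    ultimately show "(x, y) \<in> r"
      using r(2,5) by (cases "x = y") (auto simp: total_on_def refl_on_def)
  next
    fix x y assume xy: "(x, y) \<in> r"
    then have "x < n" "y < n" using r(1) by auto
    moreover have "rank x \<le> rank y" using mono[OF xy] by (cases "x = y") auto
    ultimately show "(x, y) \<in> order_of_fun n g"
      using in_order_of_fun[OF g(1), of "rank x" "rank y"] g_rank rank_less by simp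
  qed
  with g show ?thesis by (rule that)
qed

text \<open>The negation of \<open>a < c \<or> b < c\<close> says that \<open>g a\<close> and
  \<open>g b\<close> both lie in the suffix starting with \<open>g c\<close>, so a violation of the
  order condition is a failure of extremeness in that suffix.\<close>

lemma AT_free_order_of_fun:
  assumes "pverts G = {..<n}" "inj_on g {..<n}" "g ` {..<n} = {..<n}"
  shows "AT_free_order G (order_of_fun n g) \<longleftrightarrow> (\<forall>j \<in> {0..<n}. extreme G (g j) (g ` {j..<n}))"
proof -
  note iff = in_order_of_fun[OF assms(2)]
  have strict: "(g a, g b) \<in> order_of_fun n g - Id \<longleftrightarrow> a < b" if "a < n" "b < n" for a b
    using iff[OF that] inj_on_eq_iff[OF assms(2), of a b] that by auto
  have "AT_free_order G (order_of_fun n g) \<longleftrightarrow>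
      (\<forall>x \<in> g ` {..<n}. \<forall>y \<in> g ` {..<n}. \<forall>z \<in> g ` {..<n}. z \<in> between G x y \<longrightarrow>
        (x, z) \<in> order_of_fun n g - Id \<or> (y, z) \<in> order_of_fun n g - Id)"
    using linear_order_of_fun[OF assms(2,3)]
    unfolding AT_free_order_def assms(1,3) by (auto simp: between_def assms(1))
  also have "\<dots> \<longleftrightarrow> (\<forall>a \<in> {..<n}. \<forall>b \<in> {..<n}. \<forall>c \<in> {..<n}. g c \<in> between G (g a) (g b) \<longrightarrow>
        (g a, g c) \<in> order_of_fun n g - Id \<or> (g b, g c) \<in> order_of_fun n g - Id)"
    by (simp only: ball_simps)
  also have "\<dots> \<longleftrightarrow> (\<forall>a \<in> {..<n}. \<forall>b \<in> {..<n}. \<forall>c \<in> {..<n}.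
        g c \<in> between G (g a) (g b) \<longrightarrow> a < c \<or> b < c)"
    by (intro ball_cong refl) (simp only: strict lessThan_iff)
  also have "\<dots> \<longleftrightarrow> (\<forall>j \<in> {0..<n}. extreme G (g j) (g ` {j..<n}))"
  proof (intro iffI ballI impI)
    fix j assume "\<forall>a \<in> {..<n}. \<forall>b \<in> {..<n}. \<forall>c \<in> {..<n}.
        g c \<in> between G (g a) (g b) \<longrightarrow> a < c \<or> b < c" "j \<in> {0..<n}"
    then show "extreme G (g j) (g ` {j..<n})" by (fastforce simp: extreme_def)
  next
    fix a b c assume "\<forall>j \<in> {0..<n}. extreme G (g j) (g ` {j..<n})" "c \<in> {..<n}"
      and abc: "a \<in> {..<n}" "b \<in> {..<n}" "g c \<in> between G (g a) (g b)"
    then have "extreme G (g c) (g ` {c..<n})" by simp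
    with abc have "\<not> (a \<in> {c..<n} \<and> b \<in> {c..<n})" by (auto simp: extreme_def)
    with abc show "a < c \<or> b < c" by auto
  qed
  finally show ?thesis .
qed

lemma start_trancl_iff:
  assumes "pair_graph G" "pverts G = {..<n}"
  shows "(i, j) \<in> (start G n z)\<^sup>+ \<longleftrightarrow> path_avoiding G (closed_neighborhood G z) i j"
proof -
  interpret pair_graph G by fact
  let ?A = "closed_neighborhood G z"
  have start: "(a, b) \<in> start G n z \<longleftrightarrow> a \<in> pverts G - ?A \<and> (a = b \<or> (a, b) \<in> arcs_avoiding G ?A)"
    for a b
    using assms(2) in_arcsD1[of a b] in_arcsD2[of a b]
    by (auto simp: start_def arcs_avoiding_def closed_neighborhood_def neighborhood_def)
  show ?thesis
  proof
    assume "(i, j) \<in> (start G n z)\<^sup>+"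
    then show "path_avoiding G ?A i j"
      unfolding path_avoiding_iff
      by induction (auto simp: start intro: rtrancl_into_rtrancl)
  next
    assume ij: "path_avoiding G ?A i j"
    then have "(i, j) \<in> (arcs_avoiding G ?A)\<^sup>*" and i: "i \<in> pverts G - ?A"
      by (auto simp: path_avoiding_iff)
    then show "(i, j) \<in> (start G n z)\<^sup>+"
    proof induction
      case base
      with i show ?case by (auto simp: start)
    next
      case (step y w)
      then have "(y, w) \<in> start G n z"
        by (auto simp: start arcs_avoiding_def dest: in_arcsD1)
      with step show ?case by (auto intro: trancl_into_trancl)
    qed
  qed
qed

section \<open>The complete program, its correctness and its total running time\<close>

definition prepare :: com where
  "prepare = Seq make_mul (Seq make_reach (Seq make_out
     (Seq (Assign ''D'' (Const 1)) (Assign ''pos'' (Const 0)))))"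

definition generator :: com where
  "generator = Seq prepare (While running search_step)"

context
  fixes G :: "nat pair_pre_digraph" and n :: nat
  assumes graph: "pair_graph G" and verts: "pverts G = {..<n}" and AT_free: "AT_free G"
begin

interpretation pair_graph G by (rule graph)

interpretation search n "\<lambda>z. (start G n z)\<^sup>+" .

lemma E_eq_extreme: "E = extreme G"
  by (intro ext) (auto simp: E_def extreme_def start_trancl_iff[OF graph verts] between_iff)

lemma branching_extreme: "branching (extreme G) n"
proof
  show "extreme G z {z}" for z
    using between_nonadjacent(4)[of z z z] by (auto simp: extreme_def closed_neighborhood_def)
  show "2 \<le> card {z \<in> S. extreme G z S}" if "S \<subseteq> {..<n}" "2 \<le> card S" for S
    using two_extreme[OF AT_free, of S] that verts by simp
qed

lemma hoare_prepare:
  "hoare (\<lambda>s. s = input n G) prepare (1300 * (n + 20) ^ 4)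
     (\<lambda>s. \<exists>f p. node f 0 p s \<and> p 0 = 0 \<and> (\<forall>m < n. f m = m))"
proof -
  let ?F = "\<lambda>s. graph_memory G n s \<and> s ''reach'' = (\<lambda>_. 0)"
  have 1: "hoare (\<lambda>s. s ''n'' 0 = n \<and> s ''mul'' 0 = 0 \<and> ?F s) make_mul (100 * (n + 1)\<^sup>2)
      (\<lambda>s. environment G n s \<and> (\<forall>z < n. reached n s z = {}))"
    by (rule hoare_conseq[OF make_mul[where F = ?F]])
      (auto simp: graph_memory_def environment_def reached_def)
  have 2: "hoare (\<lambda>s. environment G n s \<and> (\<forall>z < n. reached n s z = {})) make_reach
      (1000 * (n + 1) ^ 4) (\<lambda>s. s ''n'' 0 = n \<and> tables s)"
    by (rule hoare_conseq[OF make_reach]) (auto simp: tables_def mul_table_def)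
  have 3: "hoare (\<lambda>s. s ''n'' 0 = n \<and> tables s) make_out (100 * (n + 1))
      (\<lambda>s. (\<forall>m < n. s ''out'' m = m) \<and> tables s)"
    by (rule make_out) auto
  have 4: "hoare (\<lambda>s. (\<forall>m < n. s ''out'' m = m) \<and> tables s)
      (Seq (Assign ''D'' (Const 1)) (Assign ''pos'' (Const 0))) 10
      (\<lambda>s. \<exists>f p. node f 0 p s \<and> p 0 = 0 \<and> (\<forall>m < n. f m = m))"
    by (rule hoare_simple) (auto simp: node_def)
  show ?thesis unfolding prepare_def
  proof (rule hoare_conseq[OF hoare_Seq[OF 1 hoare_Seq[OF 2 hoare_Seq[OF 3 4]]]])
    fix s assume s: "s = input n G"
    have "i * n + j < n * n" if "i < n" "j < n" for i j
    proof -
      have "i * n + j < Suc i * n" using that by simp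
      also have "\<dots> \<le> n * n" using that by (intro mult_right_mono) auto
      finally show ?thesis .
    qed
    then show "s ''n'' 0 = n \<and> s ''mul'' 0 = 0 \<and> ?F s"
      by (auto simp: s input_def graph_memory_def)
  next
    show "100 * (n + 1)\<^sup>2 + (1000 * (n + 1) ^ 4 + (100 * (n + 1) + 10)) \<le> 1300 * (n + 20) ^ 4"
      by (simp add: power2_eq_square power4_eq_xxxx algebra_simps)
  qed auto
qed

lemma orders_eq:
  assumes "\<forall>m < n. f m = m"
  shows "order_of_fun n ` set (gen (extreme G) n n f) = {r. AT_free_order G r}"
    and "inj_on (order_of_fun n) (set (gen (extreme G) n n f))"
proof -
  have f: "inj_on f {..<n}" "f ` {..<n} = {..<n}" using assms by (auto simp: inj_on_def)
  have set: "set (gen (extreme G) n n f) = {g. inj_on g {..<n} \<and> (\<forall>j \<ge> n. g j = f j) \<and>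
      g ` {..<n} = {..<n} \<and> AT_free_order G (order_of_fun n g)}" (is "_ = ?S")
    unfolding set_gen[OF order_refl f(1)]
    using AT_free_order_of_fun[OF verts] f(2) by (auto simp: atLeast0LessThan)
  show "inj_on (order_of_fun n) (set (gen (extreme G) n n f))"
  proof (rule inj_onI)
    fix g h assume gh: "g \<in> set (gen (extreme G) n n f)" "h \<in> set (gen (extreme G) n n f)"
      "order_of_fun n g = order_of_fun n h"
    then have "g j = h j" for j
      using order_of_fun_inj[of g n h j] by (cases "j < n") (auto simp: set)
    then show "g = h" by auto
  qed
  show "order_of_fun n ` set (gen (extreme G) n n f) = {r. AT_free_order G r}"
  proof (intro set_eqI iffI; clarify)
    fix r assume r: "AT_free_order G r"
    then obtain g where g: "inj_on g {..<n}" "g ` {..<n} = {..<n}" "order_of_fun n g = r"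
      using exists_order_of_fun[of n r] unfolding AT_free_order_def verts by blast
    \<comment> \<open>Outputs of the search agree with the initial array from cell \<open>n\<close>
      on, so \<open>g\<close> is adjusted there; the order depends only on the cells below
      \<open>n\<close>.\<close>
    define h where "h j = (if j < n then g j else f j)" for j
    have "inj_on h {..<n}" using g(1) by (simp add: h_def inj_on_def)
    moreover have "h ` {..<n} = {..<n}" using g(2) by (simp add: h_def)
    moreover have "order_of_fun n h = r"
      unfolding g(3)[symmetric] order_of_fun_def h_def by (intro Collect_cong ex_cong1) auto
    ultimately have "h \<in> ?S" using r by (simp add: h_def)
    with \<open>order_of_fun n h = r\<close> show "r \<in> order_of_fun n ` set (gen (extreme G) n n f)"
      by (auto simp: set)
  qed (simp add: set)
qed

lemma exec_generator:
  "\<exists>t os s'. exec generator (input n G) t os s' \<and>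
    lists_each_once (pverts G) (map (\<lambda>a. map a [0..<n]) os) {r. AT_free_order G r} \<and>
    t \<le> 1000000000 * card {r. AT_free_order G r}"
proof -
  obtain t1 s1 where 1: "exec prepare (input n G) t1 [] s1"
    "t1 \<le> 1300 * (n + 20) ^ 4" "\<exists>f p. node f 0 p s1 \<and> p 0 = 0 \<and> (\<forall>m < n. f m = m)"
    using hoareD[OF hoare_prepare refl] .
  then obtain f p where fp: "node f 0 p s1" "p 0 = 0" "\<forall>m < n. f m = m" by blast
  have f: "inj_on f {..<n}" "f ` {..<n} = {..<n}" using fp(3) by (auto simp: inj_on_def)
  define os where "os = gen (extreme G) n n f"
  obtain t2 s2 where 2: "exec (While running search_step) s1 t2 os s2"
      "t2 \<le> gen_cost (extreme G) n 1000 n f + 5"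
    using exec_search[OF fp(1) _ fp(2)] fp(3) unfolding E_eq_extreme os_def by auto
  have "exec generator (input n G) (t1 + t2) os s2"
    using exec.Seq[OF 1(1) 2(1)] by (simp add: generator_def)
  moreover have "lists_each_once (pverts G) (map (\<lambda>a. map a [0..<n]) os) {r. AT_free_order G r}"
  proof -
    have "distinct (map a [0..<n]) \<and> set (map a [0..<n]) = {..<n}" if "a \<in> set os" for a
      using that f set_gen[OF order_refl f(1), of "extreme G"]
      by (auto simp: os_def distinct_map atLeast0LessThan)
    moreover have orders: "map order_of_list (map (\<lambda>a. map a [0..<n]) os) = map (order_of_fun n) os"
      by (simp add: order_of_list_map)
    moreover have "distinct (map (order_of_fun n) os)"
      using orders_eq(2)[OF fp(3)] distinct_gen[OF order_refl f(1)] by (simp add: os_def distinct_map)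
    moreover have "set (map (order_of_fun n) os) = {r. AT_free_order G r}"
      using orders_eq(1)[OF fp(3)] by (simp add: os_def)
    ultimately show ?thesis unfolding lists_each_once_def verts orders by auto
  qed
  \<comment> \<open>Per order, the preprocessing takes at most 1300 * 20 ^ 4 * 2 = 416000000 steps
    and the search 10 ^ 7; as there is at least one order, the 5 extra steps fit as well.\<close>
  moreover have "t1 + t2 \<le> 1000000000 * card {r. AT_free_order G r}"
  proof -
    have card: "card {r. AT_free_order G r} = length os"
      using orders_eq[OF fp(3)] distinct_gen[OF order_refl f(1), of "extreme G"]
      by (metis card_image distinct_card os_def)
    have cost: "gen_cost (extreme G) n 1000 n f + 1000 * (n + 20) ^ 3 \<le> 10000 * 1000 * length os"
      unfolding os_def by (rule branching.gen_cost_le[OF branching_extreme order_refl f])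
    have len: "2 ^ n \<le> 2 * length os"
      unfolding os_def by (rule branching.length_gen_ge[OF branching_extreme order_refl f])
    have "1 \<le> length os" using len by (cases os) auto
    have "t1 \<le> 1300 * (20 ^ 4 * 2 ^ n)"
      using 1(2) mult_left_mono[OF power4_le_exp[of n]] by (rule order_trans) simp
    also have "\<dots> \<le> 1300 * (20 ^ 4 * (2 * length os))"
      using len by (intro mult_left_mono) simp_all
    finally have "t1 \<le> 1300 * (20 ^ 4 * (2 * length os))" .
    moreover have "t2 \<le> 10000 * 1000 * length os + 5"
      using 2(2) cost by simp
    ultimately show ?thesis using \<open>1 \<le> length os\<close> unfolding card by simp
  qed
  ultimately show ?thesis by blast
qed

end

theorem theorem3p3:
  shows "\<exists>(P :: com) (C :: nat). \<forall>(n :: nat) (G :: nat pair_pre_digraph).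
    pair_graph G \<and> pverts G = {..<n} \<and> AT_free G \<longrightarrow>
      (\<exists>t os s'. exec P (input n G) t os s' \<and>
        lists_each_once (pverts G) (map (\<lambda>a. map a [0..<n]) os) {r. AT_free_order G r} \<and>
        t \<le> C * card {r. AT_free_order G r})"
  using exec_generator by blast

end
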